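(* (i) Let $(M,g,J)$ be a Hermitian manifold of real dimension $2m+2$ with $Hol(\nabla^a)\subset U(m)\times U(1)$, with corresponding splitting $TM=\mathcal{H}\oplus\mathcal{V}$, and $$T^a\in\Lambda^{2,0}\mathcal{H}^*\otimes\Lambda^{0,1}\mathcal{V}^*\oplus\Lambda^{0,2}\mathcal{H}^*\otimes\Lambda^{1,0}\mathcal{V}^*.$$ Then $(M,g,\hat J)$ is nearly Kähler and its canonical Hermitian connection coincides with $\nabla^a$. (ii) Conversely, let $(M,g,J)$ be a nearly Kähler manifold of real dimension $2m+2$ with $Hol(\nabla^a)\subset U(m)\times U(1)$, with corresponding splitting $TM=\mathcal{H}\oplus\mathcal{V}$, and $$T^a\in\Lambda^{2,0}\mathcal{H}^*\otimes\Lambda^{1,0}\mathcal{V}^*\oplus\Lambda^{0,2}\mathcal{H}^*\otimes\Lambda^{0,1}\mathcal{V}^*.$$ Then $(M,g,\hat J)$ is Hermitian and its unique Hermitian connection with totally skew-symmetric torsion coincides with $\nabla^a$. Here $\hat J$ is the almost complex structure defined by $\hat J|_{\mathcal{H}}=J|_{\mathcal{H}}$, $\hat J|_{\mathcal{V}}=-J|_{\mathcal{V}}$.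
   Context: Manifolds are smooth and connected. An almost Hermitian manifold $(M,g,J)$ is in the Gray–Hervella class $\mathcal{G}_1$ if its Nijenhuis tensor is totally skew-symmetric; equivalently, there is a connection $\nabla^a$ with $\nabla^ag=0$, $\nabla^aJ=0$ whose torsion $T^a$, viewed as $T^a(X,Y,Z)=g(T^a(X,Y),Z)$, is a 3-form; this connection is then unique, and $\nabla^a=\nabla+\frac12T^a$ with $\nabla$ the Levi-Civita connection. $\mathcal{G}_1$ contains the Hermitian manifolds ($J$ integrable; equivalently $T^a$ of type $(2,1)+(1,2)$) and the nearly Kähler manifolds ($(\nabla_XJ)X=0$ for all $X$; equivalently $T^a$ of type $(3,0)+(0,3)$). For a nearly Kähler manifold, $\nabla^a$ equals the canonical Hermitian connection $\nabla^c=\nabla-\frac12J(\nabla J)$. $Hol(\nabla^a)\subset U(m)\times U(1)\subset U(m+1)$ means that there is a (fixed) $\nabla^a$-parallel, $g$-orthogonal, $J$-invariant splitting $TM=\mathcal{H}\oplus\mathcal{V}$ with real ranks $2m$ and $2$. $\Lambda^{p,q}\mathcal{H}^*$, $\Lambda^{p,q}\mathcal{V}^*$ are the complex $(p,q)$-forms on $\mathcal{H}$, $\mathcal{V}$ with respect to $J$ (extended by zero), and tensor products of them are embedded in $\Lambda^3T^*M\otimes\mathbb{C}$ by the wedge product. *)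

theory Defs
  imports "HOL-Analysis.Analysis" "HOL-Library.Function_Algebras"
begin

(* Pointwise real vector space structure on functions. It makes derivations, vector fields and
   multilinear forms elements of real vector spaces, so that subspace, span and independent apply. *)
instantiation "fun" :: (type, real_vector) real_vector
begin

definition scaleR_fun :: "real \<Rightarrow> ('a \<Rightarrow> 'b) \<Rightarrow> 'a \<Rightarrow> 'b" where
  "scaleR_fun c f = (\<lambda>x. c *\<^sub>R f x)"

instance
  by standard (simp_all add: scaleR_fun_def fun_eq_iff scaleR_add_right scaleR_add_left)

end


section \<open>Smooth manifolds\<close>

(* Only meaningful for open S. *)
primrec Ck_on :: "nat \<Rightarrow> 'e::real_normed_vector set \<Rightarrow> ('e \<Rightarrow> 'f::real_normed_vector) \<Rightarrow> bool" where
  "Ck_on 0 S f = continuous_on S f"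
| "Ck_on (Suc k) S f =
    ((\<forall>x\<in>S. f differentiable (at x)) \<and> (\<forall>v. Ck_on k S (\<lambda>x. frechet_derivative f (at x) v)))"

definition smooth_on :: "'e::real_normed_vector set \<Rightarrow> ('e \<Rightarrow> 'f::real_normed_vector) \<Rightarrow> bool" where
  "smooth_on S f \<longleftrightarrow> (\<forall>k. Ck_on k S f)"

(* The underlying set of the manifold is the whole type 'a; an element (U, \<phi>) is a chart with
   domain U. The atlas need not be maximal. *)
type_synonym ('a, 'e) atlas = "('a set \<times> ('a \<Rightarrow> 'e)) set"

definition manifold :: "('a::{t2_space,second_countable_topology}, 'e::euclidean_space) atlas \<Rightarrow> bool" where
  "manifold A \<longleftrightarrow>
    (\<forall>(U, \<phi>)\<in>A. open U \<and> open (\<phi> ` U) \<and> homeomorphism U (\<phi> ` U) \<phi> (inv_into U \<phi>)) \<and>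
    (\<Union>(U, \<phi>)\<in>A. U) = UNIV \<and>
    (\<forall>(U, \<phi>)\<in>A. \<forall>(W, \<psi>)\<in>A. smooth_on (\<phi> ` (U \<inter> W)) (\<psi> \<circ> inv_into U \<phi>))"

definition smooth_fun_on :: "('a, 'e::euclidean_space) atlas \<Rightarrow> 'a set \<Rightarrow> ('a \<Rightarrow> real) \<Rightarrow> bool" where
  "smooth_fun_on A S f \<longleftrightarrow> (\<forall>(U, \<phi>)\<in>A. smooth_on (\<phi> ` (U \<inter> S)) (f \<circ> inv_into U \<phi>))"

definition smooth_funs :: "('a, 'e::euclidean_space) atlas \<Rightarrow> ('a \<Rightarrow> real) set" where
  "smooth_funs A = {f. smooth_fun_on A UNIV f}"


section \<open>Tangent vectors and vector fields\<close>

type_synonym 'a tvec = "('a \<Rightarrow> real) \<Rightarrow> real"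
type_synonym 'a vfield = "'a \<Rightarrow> 'a tvec"

(* Tangent vectors at p are the point derivations of the algebra of smooth functions; they are
   normalised to vanish on functions that are not smooth. *)
definition tangent_space :: "('a, 'e::euclidean_space) atlas \<Rightarrow> 'a \<Rightarrow> 'a tvec set" where
  "tangent_space A p = {v.
    (\<forall>f. f \<notin> smooth_funs A \<longrightarrow> v f = 0) \<and>
    (\<forall>f\<in>smooth_funs A. \<forall>h\<in>smooth_funs A. v (f + h) = v f + v h) \<and>
    (\<forall>c. \<forall>f\<in>smooth_funs A. v (c *\<^sub>R f) = c * v f) \<and>
    (\<forall>f\<in>smooth_funs A. \<forall>h\<in>smooth_funs A. v (f * h) = f p * v h + h p * v f)}"

definition vfields_on ::
    "('a::topological_space, 'e::euclidean_space) atlas \<Rightarrow> 'a set \<Rightarrow> 'a vfield set" where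
  "vfields_on A S = {X. (\<forall>p\<in>S. X p \<in> tangent_space A p) \<and>
    (\<forall>f\<in>smooth_funs A. smooth_fun_on A S (\<lambda>p. X p f))}"

abbreviation vfields :: "('a::topological_space, 'e::euclidean_space) atlas \<Rightarrow> 'a vfield set" where
  "vfields A \<equiv> vfields_on A UNIV"

definition lie_bracket ::
    "('a, 'e::euclidean_space) atlas \<Rightarrow> 'a vfield \<Rightarrow> 'a vfield \<Rightarrow> 'a vfield" where
  "lie_bracket A X Y = (\<lambda>p f. if f \<in> smooth_funs A
     then X p (\<lambda>q. Y q f) - Y p (\<lambda>q. X q f) else 0)"


section \<open>Almost Hermitian structures\<close>

(* Tensor fields are families of multilinear maps on the tangent spaces, arbitrary off the tangent
   spaces; smoothness is tested on vector fields over open sets. *)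
type_synonym 'a metric_field = "'a \<Rightarrow> 'a tvec \<Rightarrow> 'a tvec \<Rightarrow> real"
type_synonym 'a endo_field = "'a \<Rightarrow> 'a tvec \<Rightarrow> 'a tvec"

definition riemannian_metric ::
    "('a::topological_space, 'e::euclidean_space) atlas \<Rightarrow> 'a metric_field \<Rightarrow> bool" where
  "riemannian_metric A g \<longleftrightarrow>
    (\<forall>p. \<forall>u\<in>tangent_space A p. \<forall>v\<in>tangent_space A p. \<forall>w\<in>tangent_space A p. \<forall>c.
       g p (u + v) w = g p u w + g p v w \<and> g p (c *\<^sub>R u) w = c * g p u w \<and> g p u v = g p v u) \<and>
    (\<forall>p. \<forall>u\<in>tangent_space A p. u \<noteq> 0 \<longrightarrow> g p u u > 0) \<and>
    (\<forall>S. open S \<longrightarrow> (\<forall>X\<in>vfields_on A S. \<forall>Y\<in>vfields_on A S.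
       smooth_fun_on A S (\<lambda>p. g p (X p) (Y p))))"

definition app :: "'a endo_field \<Rightarrow> 'a vfield \<Rightarrow> 'a vfield" where
  "app J X = (\<lambda>p. J p (X p))"

definition almost_complex ::
    "('a::topological_space, 'e::euclidean_space) atlas \<Rightarrow> 'a endo_field \<Rightarrow> bool" where
  "almost_complex A J \<longleftrightarrow>
    (\<forall>p. \<forall>u\<in>tangent_space A p. \<forall>v\<in>tangent_space A p. \<forall>c.
       J p u \<in> tangent_space A p \<and> J p (u + v) = J p u + J p v \<and>
       J p (c *\<^sub>R u) = c *\<^sub>R J p u \<and> J p (J p u) = - u) \<and>
    (\<forall>S. open S \<longrightarrow> (\<forall>X\<in>vfields_on A S. app J X \<in> vfields_on A S))"

definition almost_hermitian ::
    "('a::topological_space, 'e::euclidean_space) atlas \<Rightarrow> 'a metric_field \<Rightarrow> 'a endo_field \<Rightarrow> bool" where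
  "almost_hermitian A g J \<longleftrightarrow> riemannian_metric A g \<and> almost_complex A J \<and>
    (\<forall>p. \<forall>u\<in>tangent_space A p. \<forall>v\<in>tangent_space A p. g p (J p u) (J p v) = g p u v)"

definition nijenhuis ::
    "('a, 'e::euclidean_space) atlas \<Rightarrow> 'a endo_field \<Rightarrow> 'a vfield \<Rightarrow> 'a vfield \<Rightarrow> 'a vfield" where
  "nijenhuis A J X Y =
    lie_bracket A (app J X) (app J Y) - lie_bracket A X Y
    - app J (lie_bracket A (app J X) Y) - app J (lie_bracket A X (app J Y))"

(* Integrability of J is understood as the vanishing of the Nijenhuis tensor. *)
definition hermitian ::
    "('a::topological_space, 'e::euclidean_space) atlas \<Rightarrow> 'a metric_field \<Rightarrow> 'a endo_field \<Rightarrow> bool" where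
  "hermitian A g J \<longleftrightarrow> almost_hermitian A g J \<and>
    (\<forall>X\<in>vfields A. \<forall>Y\<in>vfields A. nijenhuis A J X Y = 0)"


section \<open>Connections\<close>

(* Connections are only meaningful on vfields A; they are compared there. *)
type_synonym 'a connection = "'a vfield \<Rightarrow> 'a vfield \<Rightarrow> 'a vfield"

definition connection ::
    "('a::topological_space, 'e::euclidean_space) atlas \<Rightarrow> 'a connection \<Rightarrow> bool" where
  "connection A D \<longleftrightarrow>
    (\<forall>X\<in>vfields A. \<forall>Y\<in>vfields A. D X Y \<in> vfields A) \<and>
    (\<forall>X\<in>vfields A. \<forall>Y\<in>vfields A. \<forall>Z\<in>vfields A.
       D (X + Y) Z = D X Z + D Y Z \<and> D X (Y + Z) = D X Y + D X Z) \<and>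
    (\<forall>X\<in>vfields A. \<forall>Y\<in>vfields A. \<forall>f\<in>smooth_funs A.
       D (\<lambda>p. f p *\<^sub>R X p) Y = (\<lambda>p. f p *\<^sub>R D X Y p) \<and>
       D X (\<lambda>p. f p *\<^sub>R Y p) = (\<lambda>p. X p f *\<^sub>R Y p + f p *\<^sub>R D X Y p))"

definition torsion ::
    "('a, 'e::euclidean_space) atlas \<Rightarrow> 'a connection \<Rightarrow> 'a vfield \<Rightarrow> 'a vfield \<Rightarrow> 'a vfield" where
  "torsion A D X Y = D X Y - D Y X - lie_bracket A X Y"

definition metric_parallel ::
    "('a::topological_space, 'e::euclidean_space) atlas \<Rightarrow> 'a metric_field \<Rightarrow> 'a connection \<Rightarrow> bool" where
  "metric_parallel A g D \<longleftrightarrow> (\<forall>X\<in>vfields A. \<forall>Y\<in>vfields A. \<forall>Z\<in>vfields A. \<forall>p.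
     X p (\<lambda>q. g q (Y q) (Z q)) = g p (D X Y p) (Z p) + g p (Y p) (D X Z p))"

definition cov_deriv_endo ::
    "'a connection \<Rightarrow> 'a endo_field \<Rightarrow> 'a vfield \<Rightarrow> 'a vfield \<Rightarrow> 'a vfield" where
  "cov_deriv_endo D J X Y = D X (app J Y) - app J (D X Y)"

definition is_levi_civita ::
    "('a::topological_space, 'e::euclidean_space) atlas \<Rightarrow> 'a metric_field \<Rightarrow> 'a connection \<Rightarrow> bool" where
  "is_levi_civita A g D \<longleftrightarrow> connection A D \<and> metric_parallel A g D \<and>
    (\<forall>X\<in>vfields A. \<forall>Y\<in>vfields A. torsion A D X Y = 0)"

(* SOME rather than THE: the connection is unique on vfields A, but arbitrary elsewhere. *)
definition levi_civita ::
    "('a::topological_space, 'e::euclidean_space) atlas \<Rightarrow> 'a metric_field \<Rightarrow> 'a connection" where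
  "levi_civita A g = (SOME D. is_levi_civita A g D)"

definition nearly_kahler ::
    "('a::topological_space, 'e::euclidean_space) atlas \<Rightarrow> 'a metric_field \<Rightarrow> 'a endo_field \<Rightarrow> bool" where
  "nearly_kahler A g J \<longleftrightarrow> almost_hermitian A g J \<and>
    (\<forall>X\<in>vfields A. cov_deriv_endo (levi_civita A g) J X X = 0)"

(* \<nabla>\<^sup>c = \<nabla> - 1/2 J (\<nabla> J) *)
definition canonical_connection ::
    "('a::topological_space, 'e::euclidean_space) atlas \<Rightarrow> 'a metric_field \<Rightarrow> 'a endo_field \<Rightarrow> 'a connection" where
  "canonical_connection A g J X Y =
    levi_civita A g X Y - (1/2) *\<^sub>R app J (cov_deriv_endo (levi_civita A g) J X Y)"

(* Hermitian connections with totally skew-symmetric torsion. *)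
definition skew_torsion_connection ::
    "('a::topological_space, 'e::euclidean_space) atlas \<Rightarrow> 'a metric_field \<Rightarrow> 'a endo_field \<Rightarrow>
     'a connection \<Rightarrow> bool" where
  "skew_torsion_connection A g J D \<longleftrightarrow> connection A D \<and> metric_parallel A g D \<and>
    (\<forall>X\<in>vfields A. \<forall>Y\<in>vfields A. cov_deriv_endo D J X Y = 0) \<and>
    (\<forall>X\<in>vfields A. \<forall>Y\<in>vfields A. \<forall>Z\<in>vfields A. \<forall>p.
       g p (torsion A D X Y p) (Z p) = - g p (torsion A D Y X p) (Z p) \<and>
       g p (torsion A D X Y p) (Z p) = - g p (torsion A D X Z p) (Y p))"


section \<open>Parallel splittings\<close>

type_synonym 'a distribution = "'a \<Rightarrow> 'a tvec set"

(* Smooth rank k subbundles of the tangent bundle, described by local frames. *)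
definition subbundle ::
    "('a::topological_space, 'e::euclidean_space) atlas \<Rightarrow> nat \<Rightarrow> 'a distribution \<Rightarrow> bool" where
  "subbundle A k H \<longleftrightarrow>
    (\<forall>p. subspace (H p) \<and> H p \<subseteq> tangent_space A p) \<and>
    (\<forall>p. \<exists>S (E :: nat \<Rightarrow> 'a vfield). open S \<and> p \<in> S \<and> (\<forall>i<k. E i \<in> vfields_on A S) \<and>
      (\<forall>q\<in>S. inj_on (\<lambda>i. E i q) {..<k} \<and> independent ((\<lambda>i. E i q) ` {..<k}) \<and>
             span ((\<lambda>i. E i q) ` {..<k}) = H q))"

definition sections ::
    "('a::topological_space, 'e::euclidean_space) atlas \<Rightarrow> 'a distribution \<Rightarrow> 'a vfield set" where
  "sections A H = {X \<in> vfields A. \<forall>p. X p \<in> H p}"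

definition parallel_subbundle ::
    "('a::topological_space, 'e::euclidean_space) atlas \<Rightarrow> 'a connection \<Rightarrow> 'a distribution \<Rightarrow> bool" where
  "parallel_subbundle A D H \<longleftrightarrow> (\<forall>X\<in>vfields A. \<forall>Y\<in>sections A H. D X Y \<in> sections A H)"

(* Hol(D) \<subseteq> U(m) x U(1), with corresponding splitting TM = H + V. *)
definition parallel_splitting ::
    "('a::topological_space, 'e::euclidean_space) atlas \<Rightarrow> 'a metric_field \<Rightarrow> 'a endo_field \<Rightarrow>
     'a connection \<Rightarrow> nat \<Rightarrow> 'a distribution \<Rightarrow> 'a distribution \<Rightarrow> bool" where
  "parallel_splitting A g J D m H V \<longleftrightarrow>
    subbundle A (2 * m) H \<and> subbundle A 2 V \<and>
    (\<forall>p. H p \<inter> V p = {0} \<and> {h + w | h w. h \<in> H p \<and> w \<in> V p} = tangent_space A p) \<and>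
    (\<forall>p. \<forall>h\<in>H p. \<forall>w\<in>V p. g p h w = 0) \<and>
    (\<forall>p. J p ` H p \<subseteq> H p \<and> J p ` V p \<subseteq> V p) \<and>
    parallel_subbundle A D H \<and> parallel_subbundle A D V"

definition J_hat :: "'a endo_field \<Rightarrow> 'a distribution \<Rightarrow> 'a distribution \<Rightarrow> 'a endo_field" where
  "J_hat J H V p v = (THE u. \<exists>h\<in>H p. \<exists>w\<in>V p. v = h + w \<and> u = J p h - J p w)"


section \<open>Complex forms and their types\<close>

(* Complex k-forms on a tangent space are complex-valued real multilinear functions of k tangent
   vectors, k-tuples being used as arguments; values off the tangent space are irrelevant. *)

lemma vector_space_complex_fun: "vector_space (\<lambda>(c::complex) (f :: 'b \<Rightarrow> complex) x. c * f x)"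
  by unfold_locales (simp_all add: fun_eq_iff algebra_simps)

definition cspan :: "('b \<Rightarrow> complex) set \<Rightarrow> ('b \<Rightarrow> complex) set" where
  "cspan = module.span (\<lambda>c f x. c * f x)"

definition complex_covectors ::
    "('a, 'e::euclidean_space) atlas \<Rightarrow> 'a \<Rightarrow> ('a tvec \<Rightarrow> complex) set" where
  "complex_covectors A p = {\<alpha>.
    (\<forall>u\<in>tangent_space A p. \<forall>v\<in>tangent_space A p. \<alpha> (u + v) = \<alpha> u + \<alpha> v) \<and>
    (\<forall>c. \<forall>u\<in>tangent_space A p. \<alpha> (c *\<^sub>R u) = c *\<^sub>R \<alpha> u)}"

(* (1,0)- and (0,1)-forms at p on the subbundle E, extended by zero on the complement F. *)
definition forms10 ::
    "('a, 'e::euclidean_space) atlas \<Rightarrow> 'a endo_field \<Rightarrow> 'a distribution \<Rightarrow> 'a distribution \<Rightarrow> 'a \<Rightarrow>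
     ('a tvec \<Rightarrow> complex) set" where
  "forms10 A J E F p = {\<alpha> \<in> complex_covectors A p.
     (\<forall>v\<in>E p. \<alpha> (J p v) = \<i> * \<alpha> v) \<and> (\<forall>v\<in>F p. \<alpha> v = 0)}"

definition forms01 ::
    "('a, 'e::euclidean_space) atlas \<Rightarrow> 'a endo_field \<Rightarrow> 'a distribution \<Rightarrow> 'a distribution \<Rightarrow> 'a \<Rightarrow>
     ('a tvec \<Rightarrow> complex) set" where
  "forms01 A J E F p = {\<alpha> \<in> complex_covectors A p.
     (\<forall>v\<in>E p. \<alpha> (J p v) = - \<i> * \<alpha> v) \<and> (\<forall>v\<in>F p. \<alpha> v = 0)}"

definition wedge11 :: "('v \<Rightarrow> complex) \<Rightarrow> ('v \<Rightarrow> complex) \<Rightarrow> 'v \<times> 'v \<Rightarrow> complex" where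
  "wedge11 \<alpha> \<beta> = (\<lambda>(x, y). \<alpha> x * \<beta> y - \<alpha> y * \<beta> x)"

definition wedge21 :: "('v \<times> 'v \<Rightarrow> complex) \<Rightarrow> ('v \<Rightarrow> complex) \<Rightarrow> 'v \<times> 'v \<times> 'v \<Rightarrow> complex" where
  "wedge21 \<omega> \<gamma> = (\<lambda>(x, y, z). \<omega> (x, y) * \<gamma> z + \<omega> (y, z) * \<gamma> x + \<omega> (z, x) * \<gamma> y)"

(* \<Lambda>\<^sup>2 L for a space L of covectors. With L = \<Lambda>\<^sup>1\<^sup>,\<^sup>0 or L = \<Lambda>\<^sup>0\<^sup>,\<^sup>1 this is \<Lambda>\<^sup>2\<^sup>,\<^sup>0 or \<Lambda>\<^sup>0\<^sup>,\<^sup>2. *)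
definition ext2 :: "('v \<Rightarrow> complex) set \<Rightarrow> ('v \<times> 'v \<Rightarrow> complex) set" where
  "ext2 L = cspan {wedge11 \<alpha> \<beta> | \<alpha> \<beta>. \<alpha> \<in> L \<and> \<beta> \<in> L}"

(* The image of P \<otimes> L in the 3-forms under the wedge product. *)
definition tensor21 ::
    "('v \<times> 'v \<Rightarrow> complex) set \<Rightarrow> ('v \<Rightarrow> complex) set \<Rightarrow> ('v \<times> 'v \<times> 'v \<Rightarrow> complex) set" where
  "tensor21 P L = cspan {wedge21 \<omega> \<gamma> | \<omega> \<gamma>. \<omega> \<in> P \<and> \<gamma> \<in> L}"

definition subspace_sum ::
    "('b \<Rightarrow> complex) set \<Rightarrow> ('b \<Rightarrow> complex) set \<Rightarrow> ('b \<Rightarrow> complex) set" where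
  "subspace_sum P Q = {\<sigma> + \<tau> | \<sigma> \<tau>. \<sigma> \<in> P \<and> \<tau> \<in> Q}"

(* \<Lambda>\<^sup>2\<^sup>,\<^sup>0H* \<otimes> \<Lambda>\<^sup>0\<^sup>,\<^sup>1V* \<oplus> \<Lambda>\<^sup>0\<^sup>,\<^sup>2H* \<otimes> \<Lambda>\<^sup>1\<^sup>,\<^sup>0V* *)
definition mixed_type ::
    "('a, 'e::euclidean_space) atlas \<Rightarrow> 'a endo_field \<Rightarrow> 'a distribution \<Rightarrow> 'a distribution \<Rightarrow> 'a \<Rightarrow>
     ('a tvec \<times> 'a tvec \<times> 'a tvec \<Rightarrow> complex) set" where
  "mixed_type A J H V p = subspace_sum
     (tensor21 (ext2 (forms10 A J H V p)) (forms01 A J V H p))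
     (tensor21 (ext2 (forms01 A J H V p)) (forms10 A J V H p))"

(* \<Lambda>\<^sup>2\<^sup>,\<^sup>0H* \<otimes> \<Lambda>\<^sup>1\<^sup>,\<^sup>0V* \<oplus> \<Lambda>\<^sup>0\<^sup>,\<^sup>2H* \<otimes> \<Lambda>\<^sup>0\<^sup>,\<^sup>1V* *)
definition pure_type ::
    "('a, 'e::euclidean_space) atlas \<Rightarrow> 'a endo_field \<Rightarrow> 'a distribution \<Rightarrow> 'a distribution \<Rightarrow> 'a \<Rightarrow>
     ('a tvec \<times> 'a tvec \<times> 'a tvec \<Rightarrow> complex) set" where
  "pure_type A J H V p = subspace_sum
     (tensor21 (ext2 (forms10 A J H V p)) (forms10 A J V H p))
     (tensor21 (ext2 (forms01 A J H V p)) (forms01 A J V H p))"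

(* The 3-form (X, Y, Z) \<mapsto> g(T(X, Y), Z) lies in W p at every point p. The values of \<tau> p on tangent
   vectors are determined, since every tangent vector extends to a vector field. *)
definition torsion_in ::
    "('a::topological_space, 'e::euclidean_space) atlas \<Rightarrow> 'a metric_field \<Rightarrow> 'a connection \<Rightarrow>
     ('a \<Rightarrow> ('a tvec \<times> 'a tvec \<times> 'a tvec \<Rightarrow> complex) set) \<Rightarrow> bool" where
  "torsion_in A g D W \<longleftrightarrow> (\<forall>p. \<exists>\<tau>\<in>W p. \<forall>X\<in>vfields A. \<forall>Y\<in>vfields A. \<forall>Z\<in>vfields A.
     \<tau> (X p, Y p, Z p) = complex_of_real (g p (torsion A D X Y p) (Z p)))"

end

(* With T the torsion of the skew connection Da, the Levi-Civita connection is Da - T/2. Since the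
   splitting is Da-parallel, Da also preserves the almost complex structure K obtained from J by
   changing sign on V. Hence nabla K and the Nijenhuis tensor of K are algebraic in T:
   (nabla_X K) Y = (K T(X,Y) - T(X,KY)) / 2 and
   N(X,Y) = T(X,Y) - T(KX,KY) + K T(KX,Y) + K T(X,KY).
   Passing from J to K exchanges (1,0)- and (0,1)-forms on V. In (i) T is therefore of type
   (3,0)+(0,3) for K, that is, T(X,KY) = -K T(X,Y), which makes nabla K skew and the canonical
   connection equal to Da. In (ii) T is of type (2,1)+(1,2) for K, which makes N vanish. *)
theory Submission
  imports Defs
begin

section \<open>Smooth functions\<close>

text \<open>The analytic obstacle is that the twisted structure K has to send smooth fields over
  every open set to smooth fields. It is given pointwise through the decomposition of a tangent
  vector, so the V-component of a smooth field must be shown smooth, starting from an arbitrary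
  local frame of V. The inverse of the Gram determinant comes from there, and calculus in charts is
  carried just far enough to support it.

  All tensor identities are tested at a point on global vector fields; a field is determined by its
  pairings with these, so no tangent vector has to be extended.

  The Levi-Civita connection is a choice, so its use rests on existence, for which Da - T/2 is the
  witness, and on uniqueness along vector fields.

  After the twist every covector on H or V is an eigencovector of K on the whole tangent space, with
  eigenvalue i or -i. Both type conditions become relations between products of eigenvalues that are
  unchanged by complex conjugation, so they hold for the two summands of each type
  simultaneously.\<close>

lemma Ck_on_subset: "Ck_on k S f \<Longrightarrow> S' \<subseteq> S \<Longrightarrow> Ck_on k S' f"
  by (induction k arbitrary: f) (auto intro: continuous_on_subset)

lemma Ck_on_SucD: "Ck_on (Suc k) S f \<Longrightarrow> Ck_on k S f"
proof (induction k arbitrary: f)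
  case 0
  then show ?case
    by (auto intro!: continuous_at_imp_continuous_on differentiable_imp_continuous_within)
next
  case (Suc k)
  then show ?case by (metis Ck_on.simps(2))
qed

text \<open>Near \<open>x\<close> the functions agree, so they have exactly the same derivatives
  there, and the choice behind \<open>frechet_derivative\<close> is made from the same
  predicate.\<close>

lemma frechet_derivative_cong_open:
  assumes "open S" "x \<in> S" "\<And>y. y \<in> S \<Longrightarrow> f y = h y"
  shows "frechet_derivative f (at x) = frechet_derivative h (at x)"
proof -
  have "(f has_derivative D) (at x) \<longleftrightarrow> (h has_derivative D) (at x)" for D
    using assms has_derivative_transform_within_open by metis
  then show ?thesis
    unfolding frechet_derivative_def by simp
qed

lemma Ck_on_cong:
  assumes "open S" "\<And>x. x \<in> S \<Longrightarrow> f x = h x" "Ck_on k S f"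
  shows "Ck_on k S h"
  using assms
proof (induction k arbitrary: f h)
  case 0
  then show ?case by (simp cong: continuous_on_cong)
next
  case (Suc k)
  have "h differentiable (at x)" if "x \<in> S" for x
  proof -
    obtain D where "(f has_derivative D) (at x)"
      using Suc.prems(3) \<open>x \<in> S\<close> by (auto simp: differentiable_def)
    then have "(h has_derivative D) (at x)"
      using Suc.prems(1,2) \<open>x \<in> S\<close> has_derivative_transform_within_open by metis
    then show ?thesis by (auto simp: differentiable_def)
  qed
  moreover have "Ck_on k S (\<lambda>x. frechet_derivative h (at x) v)" for v
  proof (rule Suc.IH[OF \<open>open S\<close>])
    show "Ck_on k S (\<lambda>x. frechet_derivative f (at x) v)"
      using Suc.prems(3) by simp
    show "frechet_derivative f (at x) v = frechet_derivative h (at x) v" if "x \<in> S" for x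
      using frechet_derivative_cong_open[OF Suc.prems(1) that Suc.prems(2)] by simp
  qed
  ultimately show ?case by simp
qed

text \<open>Lets an explicit derivative \<open>D\<close> replace \<open>frechet_derivative\<close>,
  so that the sum, product and inverse rules below reduce to the shape of the derivative.\<close>

lemma Ck_on_SucI:
  assumes "open S" "\<And>x. x \<in> S \<Longrightarrow> (f has_derivative D x) (at x)"
    "\<And>v. Ck_on k S (\<lambda>x. D x v)"
  shows "Ck_on (Suc k) S f"
proof -
  have "Ck_on k S (\<lambda>x. frechet_derivative f (at x) v)" for v
    by (rule Ck_on_cong[OF assms(1) _ assms(3)]) (simp add: frechet_derivative_at[OF assms(2), symmetric])
  with assms(2) show ?thesis by (auto simp: differentiable_def)
qed

lemma Ck_on_has_derivative:
  assumes "Ck_on (Suc k) S f" "x \<in> S"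
  shows "(f has_derivative frechet_derivative f (at x)) (at x)"
  using assms by (simp add: frechet_derivative_works)

text \<open>\<open>Ck_on\<close> uses derivatives at a point rather than within a set, so each of
  its conditions for positive order is already decided on a neighbourhood; for order 0 continuity at
  every point suffices. This allows work over the domain of a local frame.\<close>

lemma Ck_on_locally:
  assumes "\<And>x. x \<in> S \<Longrightarrow> \<exists>S'. open S' \<and> x \<in> S' \<and> Ck_on k S' f"
  shows "Ck_on k S f"
  using assms
proof (induction k arbitrary: f)
  case 0
  show ?case
    unfolding Ck_on.simps
  proof (rule continuous_at_imp_continuous_on, rule ballI)
    fix x assume "x \<in> S"
    then show "isCont f x"
      using 0 continuous_on_eq_continuous_at by fastforce
  qed
next
  case (Suc k)
  have "f differentiable (at x)" if "x \<in> S" for x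
    using Suc.prems[OF that] by auto
  moreover have "Ck_on k S (\<lambda>x. frechet_derivative f (at x) v)" for v
    using Suc.prems by (intro Suc.IH) fastforce
  ultimately show ?case by simp
qed

lemma Ck_on_const: "open S \<Longrightarrow> Ck_on k S (\<lambda>x. c)"
proof (induction k arbitrary: c)
  case (Suc k)
  then show ?case by (auto intro!: Ck_on_SucI[where D = "\<lambda>x v. 0"])
qed simp

lemma Ck_on_add:
  "open S \<Longrightarrow> Ck_on k S f \<Longrightarrow> Ck_on k S h \<Longrightarrow> Ck_on k S (\<lambda>x. f x + h x)"
proof (induction k arbitrary: f h)
  case (Suc k)
  show ?case
  proof (rule Ck_on_SucI[OF \<open>open S\<close>])
    show "((\<lambda>x. f x + h x) has_derivative
        (\<lambda>v. frechet_derivative f (at x) v + frechet_derivative h (at x) v)) (at x)" if "x \<in> S" for x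
      by (intro derivative_intros Ck_on_has_derivative[OF Suc.prems(2) that]
          Ck_on_has_derivative[OF Suc.prems(3) that])
    show "Ck_on k S (\<lambda>x. frechet_derivative f (at x) v + frechet_derivative h (at x) v)" for v
      using Suc.prems by (intro Suc.IH) auto
  qed
qed (simp add: continuous_on_add)

lemma Ck_on_mult:
  fixes f h :: "'e::real_normed_vector \<Rightarrow> real"
  shows "open S \<Longrightarrow> Ck_on k S f \<Longrightarrow> Ck_on k S h \<Longrightarrow> Ck_on k S (\<lambda>x. f x * h x)"
proof (induction k arbitrary: f h)
  case (Suc k)
  show ?case
  proof (rule Ck_on_SucI[OF \<open>open S\<close>])
    show "((\<lambda>x. f x * h x) has_derivative
        (\<lambda>v. f x * frechet_derivative h (at x) v + frechet_derivative f (at x) v * h x)) (at x)"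
      if "x \<in> S" for x
      by (intro derivative_intros Ck_on_has_derivative[OF Suc.prems(2) that]
          Ck_on_has_derivative[OF Suc.prems(3) that])
    show "Ck_on k S (\<lambda>x. f x * frechet_derivative h (at x) v + frechet_derivative f (at x) v * h x)" for v
      using Suc.prems Ck_on_SucD[OF Suc.prems(2)] Ck_on_SucD[OF Suc.prems(3)]
      by (intro Suc.IH Ck_on_add) auto
  qed
qed (simp add: continuous_on_mult)

text \<open>The derivative of 1/f is -f'/f^2, a product of C^k functions once 1/f itself is known to
  be C^k by induction.\<close>

lemma Ck_on_inverse:
  fixes f :: "'e::real_normed_vector \<Rightarrow> real"
  shows "open S \<Longrightarrow> (\<And>x. x \<in> S \<Longrightarrow> f x \<noteq> 0) \<Longrightarrow> Ck_on k S f \<Longrightarrow> Ck_on k S (\<lambda>x. inverse (f x))"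
proof (induction k)
  case (Suc k)
  show ?case
  proof (rule Ck_on_SucI[OF \<open>open S\<close>])
    show "((\<lambda>x. inverse (f x)) has_derivative
        (\<lambda>v. - (inverse (f x) * frechet_derivative f (at x) v * inverse (f x)))) (at x)"
      if "x \<in> S" for x
      by (rule Deriv.has_derivative_inverse[OF Suc.prems(2)[OF that]
            Ck_on_has_derivative[OF Suc.prems(3) that]])
    have inv: "Ck_on k S (\<lambda>x. inverse (f x))"
      using Suc Ck_on_SucD by blast
    have "Ck_on k S (\<lambda>x. (-1) * (inverse (f x) * frechet_derivative f (at x) v * inverse (f x)))" for v
      using Suc.prems by (intro Ck_on_mult Ck_on_const inv) auto
    then show "Ck_on k S (\<lambda>x. - (inverse (f x) * frechet_derivative f (at x) v * inverse (f x)))" for v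
      by simp
  qed
qed (simp add: continuous_on_inverse)

section \<open>Smooth functions on a manifold, read through charts\<close>

locale smooth_manifold =
  fixes A :: "('a::{t2_space,second_countable_topology}, 'e::euclidean_space) atlas"
  assumes manifold: "manifold A"
begin

lemma open_chart_image:
  assumes "(U, \<phi>) \<in> A" "open S"
  shows "open (\<phi> ` (U \<inter> S))"
proof -
  have "open U" "open (\<phi> ` U)" and hom: "homeomorphism U (\<phi> ` U) \<phi> (inv_into U \<phi>)"
    using manifold assms(1) by (auto simp: manifold_def)
  then have "openin (top_of_set U) (U \<inter> S)"
    using assms(2) by (simp add: openin_open_Int)
  then have "openin (top_of_set (\<phi> ` U)) (\<phi> ` (U \<inter> S))"
    by (rule homeomorphism_imp_open_map[OF hom])
  then show ?thesis
    using \<open>open (\<phi> ` U)\<close> openin_open_trans by blast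
qed

lemma chart_inv_image:
  assumes "(U, \<phi>) \<in> A" "x \<in> \<phi> ` (U \<inter> S)"
  shows "inv_into U \<phi> x \<in> U \<inter> S"
proof -
  have "homeomorphism U (\<phi> ` U) \<phi> (inv_into U \<phi>)"
    using manifold assms(1) by (auto simp: manifold_def)
  then show ?thesis
    using assms(2) by (auto simp: homeomorphism_def)
qed

lemma smooth_fun_on_iff:
  "smooth_fun_on A S f \<longleftrightarrow>
    (\<forall>U \<phi> k. (U, \<phi>) \<in> A \<longrightarrow> Ck_on k (\<phi> ` (U \<inter> S)) (\<lambda>x. f (inv_into U \<phi> x)))"
  unfolding smooth_fun_on_def smooth_on_def o_def by blast

lemma smooth_fun_on_subset: "smooth_fun_on A S f \<Longrightarrow> S' \<subseteq> S \<Longrightarrow> smooth_fun_on A S' f"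
  unfolding smooth_fun_on_iff by (meson Ck_on_subset Int_mono image_mono order_refl)

lemma smooth_fun_on_cong:
  assumes "open S" "\<And>p. p \<in> S \<Longrightarrow> f p = h p" "smooth_fun_on A S f"
  shows "smooth_fun_on A S h"
  unfolding smooth_fun_on_iff
proof (intro allI impI)
  fix U \<phi> k assume c: "(U, \<phi>) \<in> A"
  then have "Ck_on k (\<phi> ` (U \<inter> S)) (\<lambda>x. f (inv_into U \<phi> x))"
    using assms(3) by (simp add: smooth_fun_on_iff)
  then show "Ck_on k (\<phi> ` (U \<inter> S)) (\<lambda>x. h (inv_into U \<phi> x))"
    by (rule Ck_on_cong[OF open_chart_image[OF c assms(1)], rotated])
      (use chart_inv_image[OF c] assms(2) in auto)
qed

lemma smooth_fun_on_locally:
  assumes "\<And>p. p \<in> S \<Longrightarrow> \<exists>S'. open S' \<and> p \<in> S' \<and> smooth_fun_on A S' f"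
  shows "smooth_fun_on A S f"
  unfolding smooth_fun_on_iff
proof (intro allI impI, rule Ck_on_locally)
  fix U \<phi> k x assume c: "(U, \<phi>) \<in> A" and "x \<in> \<phi> ` (U \<inter> S)"
  then obtain p where p: "p \<in> U" "p \<in> S" "x = \<phi> p" by auto
  then obtain S' where S': "open S'" "p \<in> S'" "smooth_fun_on A S' f"
    using assms by blast
  then have "open (\<phi> ` (U \<inter> S'))" "x \<in> \<phi> ` (U \<inter> S')"
      "Ck_on k (\<phi> ` (U \<inter> S')) (\<lambda>x. f (inv_into U \<phi> x))"
    using c p by (auto simp: open_chart_image smooth_fun_on_iff)
  then show "\<exists>B. open B \<and> x \<in> B \<and> Ck_on k B (\<lambda>x. f (inv_into U \<phi> x))"
    by blast
qed

lemma smooth_fun_on_const: "open S \<Longrightarrow> smooth_fun_on A S (\<lambda>p. c)"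
  by (simp add: smooth_fun_on_iff Ck_on_const open_chart_image)

lemma smooth_fun_on_add:
  "open S \<Longrightarrow> smooth_fun_on A S f \<Longrightarrow> smooth_fun_on A S h \<Longrightarrow> smooth_fun_on A S (\<lambda>p. f p + h p)"
  by (simp add: smooth_fun_on_iff Ck_on_add open_chart_image)

lemma smooth_fun_on_mult:
  "open S \<Longrightarrow> smooth_fun_on A S f \<Longrightarrow> smooth_fun_on A S h \<Longrightarrow> smooth_fun_on A S (\<lambda>p. f p * h p)"
  by (simp add: smooth_fun_on_iff Ck_on_mult open_chart_image)

lemma smooth_fun_on_diff:
  assumes "open S" "smooth_fun_on A S f" "smooth_fun_on A S h"
  shows "smooth_fun_on A S (\<lambda>p. f p - h p)"
  using smooth_fun_on_add[OF assms(1,2) smooth_fun_on_mult[OF assms(1) smooth_fun_on_const assms(3)], of "-1"]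
    assms(1) by simp

lemma smooth_fun_on_inverse:
  assumes "open S" "smooth_fun_on A S f" "\<And>p. p \<in> S \<Longrightarrow> f p \<noteq> 0"
  shows "smooth_fun_on A S (\<lambda>p. inverse (f p))"
  unfolding smooth_fun_on_iff
proof (intro allI impI)
  fix U \<phi> k assume c: "(U, \<phi>) \<in> A"
  show "Ck_on k (\<phi> ` (U \<inter> S)) (\<lambda>x. inverse (f (inv_into U \<phi> x)))"
    using assms(2,3) chart_inv_image[OF c]
    by (intro Ck_on_inverse[OF open_chart_image[OF c assms(1)]]) (auto simp: smooth_fun_on_iff c)
qed

lemma smooth_funs_add: "f \<in> smooth_funs A \<Longrightarrow> h \<in> smooth_funs A \<Longrightarrow> f + h \<in> smooth_funs A"
  by (simp add: smooth_funs_def plus_fun_def smooth_fun_on_add)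

lemma smooth_funs_mult: "f \<in> smooth_funs A \<Longrightarrow> h \<in> smooth_funs A \<Longrightarrow> f * h \<in> smooth_funs A"
  by (simp add: smooth_funs_def times_fun_def smooth_fun_on_mult)

lemma smooth_funs_scale: "f \<in> smooth_funs A \<Longrightarrow> c *\<^sub>R f \<in> smooth_funs A"
  by (simp add: smooth_funs_def scaleR_fun_def smooth_fun_on_mult smooth_fun_on_const)

section \<open>Vector fields\<close>

lemma tangent_add: "u \<in> tangent_space A p \<Longrightarrow> v \<in> tangent_space A p \<Longrightarrow> u + v \<in> tangent_space A p"
  by (auto simp: tangent_space_def algebra_simps)

lemma tangent_scale: "u \<in> tangent_space A p \<Longrightarrow> c *\<^sub>R u \<in> tangent_space A p"
  by (auto simp: tangent_space_def scaleR_fun_def algebra_simps)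

lemma tangent_zero: "0 \<in> tangent_space A p"
  by (auto simp: tangent_space_def)

lemma tangent_minus: "u \<in> tangent_space A p \<Longrightarrow> - u \<in> tangent_space A p"
  using tangent_scale[of u p "-1"] by simp

lemma tangent_diff: "u \<in> tangent_space A p \<Longrightarrow> v \<in> tangent_space A p \<Longrightarrow> u - v \<in> tangent_space A p"
  using tangent_add[OF _ tangent_minus] by fastforce

lemma vfields_onD: "X \<in> vfields_on A S \<Longrightarrow> p \<in> S \<Longrightarrow> X p \<in> tangent_space A p"
  by (simp add: vfields_on_def)

lemma vfields_on_smooth: "X \<in> vfields_on A S \<Longrightarrow> f \<in> smooth_funs A \<Longrightarrow> smooth_fun_on A S (\<lambda>p. X p f)"
  by (simp add: vfields_on_def)

lemma vfields_tangent: "X \<in> vfields A \<Longrightarrow> X p \<in> tangent_space A p"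
  by (simp add: vfields_onD)

lemma vfields_on_subset: "X \<in> vfields_on A S \<Longrightarrow> S' \<subseteq> S \<Longrightarrow> X \<in> vfields_on A S'"
  using smooth_fun_on_subset unfolding vfields_on_def by blast

lemma vfields_on_cong:
  assumes "open S" "X \<in> vfields_on A S" "\<And>p. p \<in> S \<Longrightarrow> X p = Y p"
  shows "Y \<in> vfields_on A S"
  using assms smooth_fun_on_cong[OF assms(1), of "\<lambda>p. X p f" "\<lambda>p. Y p f" for f]
  by (simp add: vfields_on_def)

lemma vfields_on_add:
  "open S \<Longrightarrow> X \<in> vfields_on A S \<Longrightarrow> Y \<in> vfields_on A S \<Longrightarrow> X + Y \<in> vfields_on A S"
  by (simp add: vfields_on_def tangent_add smooth_fun_on_add)

lemma vfields_on_fun_scale: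
  "open S \<Longrightarrow> smooth_fun_on A S a \<Longrightarrow> X \<in> vfields_on A S \<Longrightarrow> (\<lambda>p. a p *\<^sub>R X p) \<in> vfields_on A S"
  by (simp add: vfields_on_def tangent_scale) (simp add: scaleR_fun_def smooth_fun_on_mult)

lemma vfields_on_scale: "open S \<Longrightarrow> X \<in> vfields_on A S \<Longrightarrow> c *\<^sub>R X \<in> vfields_on A S"
  using vfields_on_fun_scale[OF _ smooth_fun_on_const, of S X c] by (simp add: scaleR_fun_def)

lemma vfields_on_diff:
  "open S \<Longrightarrow> X \<in> vfields_on A S \<Longrightarrow> Y \<in> vfields_on A S \<Longrightarrow> X - Y \<in> vfields_on A S"
  using vfields_on_add[OF _ _ vfields_on_scale, of S X Y "-1"] by simp

lemmas vfields_add = vfields_on_add[OF open_UNIV]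
  and vfields_scale = vfields_on_scale[OF open_UNIV]
  and vfields_diff = vfields_on_diff[OF open_UNIV]

lemma vfields_zero: "0 \<in> vfields A"
  by (simp add: vfields_on_def tangent_zero smooth_fun_on_const)

lemma vfields_minus: "X \<in> vfields A \<Longrightarrow> - X \<in> vfields A"
  using vfields_scale[of X "-1"] by simp

lemma vfields_deriv: "X \<in> vfields A \<Longrightarrow> f \<in> smooth_funs A \<Longrightarrow> (\<lambda>p. X p f) \<in> smooth_funs A"
  by (simp add: smooth_funs_def vfields_on_def)

section \<open>Derivation rules and the Lie bracket\<close>

lemma tangent_fun_add:
  "v \<in> tangent_space A p \<Longrightarrow> f \<in> smooth_funs A \<Longrightarrow> h \<in> smooth_funs A \<Longrightarrow> v (\<lambda>q. f q + h q) = v f + v h"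
  by (simp add: tangent_space_def plus_fun_def)

lemma tangent_fun_scale: "v \<in> tangent_space A p \<Longrightarrow> f \<in> smooth_funs A \<Longrightarrow> v (\<lambda>q. c * f q) = c * v f"
  by (simp add: tangent_space_def scaleR_fun_def)

lemma tangent_fun_mult:
  "v \<in> tangent_space A p \<Longrightarrow> f \<in> smooth_funs A \<Longrightarrow> h \<in> smooth_funs A \<Longrightarrow>
    v (\<lambda>q. f q * h q) = f p * v h + h p * v f"
  by (simp add: tangent_space_def times_fun_def)

lemma smooth_funs_mult': "f \<in> smooth_funs A \<Longrightarrow> h \<in> smooth_funs A \<Longrightarrow> (\<lambda>q. f q * h q) \<in> smooth_funs A"
  using smooth_funs_mult by (simp add: times_fun_def)

text \<open>The commutator of two derivations is a derivation: in the Leibniz rule the cross terms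
  \<open>X p f * Y p h\<close> and \<open>Y p f * X p h\<close> appear with both signs and cancel.
  The value 0 off the smooth functions is the normalisation required by
  \<open>tangent_space\<close>.\<close>

lemma lie_bracket_tangent:
  assumes X: "X \<in> vfields A" and Y: "Y \<in> vfields A"
  shows "lie_bracket A X Y p \<in> tangent_space A p"
proof -
  note t = vfields_tangent[OF X] vfields_tangent[OF Y] and d = vfields_deriv[OF X] vfields_deriv[OF Y]
  show ?thesis
    unfolding tangent_space_def mem_Collect_eq
  proof (intro conjI allI ballI impI)
    fix f h :: "'a \<Rightarrow> real" and c assume f: "f \<in> smooth_funs A"
    show "lie_bracket A X Y p (c *\<^sub>R f) = c * lie_bracket A X Y p f"
      using f smooth_funs_scale[OF f, of c]
      by (simp add: lie_bracket_def scaleR_fun_def tangent_fun_scale[OF t(1)]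
          tangent_fun_scale[OF t(2)] d right_diff_distrib)
    assume h: "h \<in> smooth_funs A"
    show "lie_bracket A X Y p (f + h) = lie_bracket A X Y p f + lie_bracket A X Y p h"
      using f h smooth_funs_add[OF f h]
      by (simp add: lie_bracket_def plus_fun_def tangent_fun_add[OF t(1)] tangent_fun_add[OF t(2)] d)
    show "lie_bracket A X Y p (f * h) = f p * lie_bracket A X Y p h + h p * lie_bracket A X Y p f"
      using f h smooth_funs_mult[OF f h]
      by (simp add: lie_bracket_def times_fun_def smooth_funs_mult' tangent_fun_add[OF t(1)]
          tangent_fun_add[OF t(2)] tangent_fun_mult[OF t(1)] tangent_fun_mult[OF t(2)] d)
        (simp add: algebra_simps)
  qed (simp add: lie_bracket_def)
qed

lemma lie_bracket_vfields:
  assumes "X \<in> vfields A" "Y \<in> vfields A"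
  shows "lie_bracket A X Y \<in> vfields A"
proof -
  have "smooth_fun_on A UNIV (\<lambda>p. X p (\<lambda>q. Y q f) - Y p (\<lambda>q. X q f))" if "f \<in> smooth_funs A" for f
    using assms that by (simp add: smooth_fun_on_diff vfields_on_smooth vfields_deriv)
  then show ?thesis
    using lie_bracket_tangent[OF assms] by (auto simp: vfields_on_def lie_bracket_def)
qed

lemma lie_bracket_skew: "lie_bracket A X Y = - lie_bracket A Y X"
  by (auto simp: lie_bracket_def fun_eq_iff)

lemma lie_bracket_add_left:
  assumes "X \<in> vfields A" "Y \<in> vfields A" "Z \<in> vfields A"
  shows "lie_bracket A (X + Y) Z = lie_bracket A X Z + lie_bracket A Y Z"
  using assms
  by (auto simp: lie_bracket_def fun_eq_iff tangent_fun_add[OF vfields_tangent[OF assms(3)]]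
      vfields_deriv)

lemma lie_bracket_fun_left:
  assumes "X \<in> vfields A" "Y \<in> vfields A" "f \<in> smooth_funs A"
  shows "lie_bracket A (\<lambda>p. f p *\<^sub>R X p) Y = (\<lambda>p. f p *\<^sub>R lie_bracket A X Y p - Y p f *\<^sub>R X p)"
proof (intro ext)
  fix p h
  \<comment> \<open>The equation is one of functions on all \<open>h\<close>. For non-smooth
    \<open>h\<close> both brackets are 0 by default, and the correction term must vanish as
    well.\<close>
  have "X p h = 0" if "h \<notin> smooth_funs A"
    using vfields_tangent[OF assms(1), of p] that by (simp add: tangent_space_def)
  then show "lie_bracket A (\<lambda>p. f p *\<^sub>R X p) Y p h = (f p *\<^sub>R lie_bracket A X Y p - Y p f *\<^sub>R X p) h"
    using assms
    by (auto simp: lie_bracket_def scaleR_fun_def tangent_fun_mult[OF vfields_tangent[OF assms(2)]]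
        vfields_deriv        algebra_simps)
qed

end

section \<open>Connections with skew torsion\<close>

locale riemannian_manifold = smooth_manifold A
  for A :: "('a::{t2_space,second_countable_topology}, 'e::euclidean_space) atlas" +
  fixes g :: "'a metric_field"
  assumes metric: "riemannian_metric A g"
begin

lemma g_add_left:
  assumes "u \<in> tangent_space A p" "v \<in> tangent_space A p" "w \<in> tangent_space A p"
  shows "g p (u + v) w = g p u w + g p v w"
  using metric[unfolded riemannian_metric_def, THEN conjunct1, rule_format, OF assms] by simp

lemma g_sym:
  assumes "u \<in> tangent_space A p" "v \<in> tangent_space A p"
  shows "g p u v = g p v u"
  using metric[unfolded riemannian_metric_def, THEN conjunct1, rule_format, OF assms assms(2)] by simp

lemma g_scale_left:
  assumes "u \<in> tangent_space A p" "w \<in> tangent_space A p"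
  shows "g p (c *\<^sub>R u) w = c * g p u w"
  using metric[unfolded riemannian_metric_def, THEN conjunct1, rule_format, OF assms(1,1,2)] by simp

lemma g_minus_left:
  "u \<in> tangent_space A p \<Longrightarrow> w \<in> tangent_space A p \<Longrightarrow> g p (- u) w = - g p u w"
  using g_scale_left[of u p w "-1"] by simp

lemma g_diff_left:
  "u \<in> tangent_space A p \<Longrightarrow> v \<in> tangent_space A p \<Longrightarrow> w \<in> tangent_space A p \<Longrightarrow>
    g p (u - v) w = g p u w - g p v w"
  using g_add_left[of u p "-v" w] by (simp add: g_minus_left tangent_minus)

lemma g_add_right:
  "u \<in> tangent_space A p \<Longrightarrow> v \<in> tangent_space A p \<Longrightarrow> w \<in> tangent_space A p \<Longrightarrow>
    g p w (u + v) = g p w u + g p w v"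
  using g_add_left g_sym tangent_add by metis

lemma g_scale_right:
  "u \<in> tangent_space A p \<Longrightarrow> w \<in> tangent_space A p \<Longrightarrow> g p w (c *\<^sub>R u) = c * g p w u"
  using g_scale_left g_sym tangent_scale by metis

lemma g_minus_right:
  "u \<in> tangent_space A p \<Longrightarrow> w \<in> tangent_space A p \<Longrightarrow> g p w (- u) = - g p w u"
  using g_scale_right[of u p w "-1"] by simp

lemma g_diff_right:
  "u \<in> tangent_space A p \<Longrightarrow> v \<in> tangent_space A p \<Longrightarrow> w \<in> tangent_space A p \<Longrightarrow>
    g p w (u - v) = g p w u - g p w v"
  using g_add_right[of u p "-v" w] by (simp add: g_minus_right tangent_minus)

lemma g_pos: "u \<in> tangent_space A p \<Longrightarrow> u \<noteq> 0 \<Longrightarrow> g p u u > 0"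
  using metric by (simp add: riemannian_metric_def)

lemma g_smooth:
  "open S \<Longrightarrow> X \<in> vfields_on A S \<Longrightarrow> Y \<in> vfields_on A S \<Longrightarrow> smooth_fun_on A S (\<lambda>p. g p (X p) (Y p))"
  using metric by (simp add: riemannian_metric_def)

lemmas g_bilinear = g_add_left g_add_right g_diff_left g_diff_right g_minus_left g_minus_right
  g_scale_left g_scale_right

lemmas tangent_closed = tangent_add tangent_diff tangent_minus tangent_scale tangent_zero

text \<open>Positive definiteness applied to the test field \<open>X - Y\<close>, which is itself
  global.\<close>

lemma vfields_eqI:
  assumes "X \<in> vfields A" "Y \<in> vfields A"
    and eq: "\<And>Z p. Z \<in> vfields A \<Longrightarrow> g p (X p) (Z p) = g p (Y p) (Z p)"
  shows "X = Y"
proof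
  fix p
  have "g p (X p - Y p) (X p - Y p) = 0"
    using eq[OF vfields_diff[OF assms(1,2)], of p] assms(1,2)
    by (simp add: g_diff_left vfields_tangent tangent_closed)
  then show "X p = Y p"
    using g_pos[of "X p - Y p" p] assms(1,2) by (force simp: vfields_tangent tangent_closed)
qed

text \<open>The difference \<open>b\<close> of two torsion-free metric connections is symmetric in
  its first two slots and skew in its last two, and such a trilinear expression vanishes.\<close>

lemma levi_civita_unique:
  assumes D: "is_levi_civita A g D" and D': "is_levi_civita A g D'"
    and X: "X \<in> vfields A" and Y: "Y \<in> vfields A"
  shows "D X Y = D' X Y"
proof (rule vfields_eqI)
  have vf: "D X Y \<in> vfields A" "D' X Y \<in> vfields A" if "X \<in> vfields A" "Y \<in> vfields A" for X Y
    using D D' that by (auto simp: is_levi_civita_def connection_def)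
  show "D X Y \<in> vfields A" "D' X Y \<in> vfields A" using vf X Y by auto
  fix Z p assume Z: "Z \<in> vfields A"
  define b where "b X Y Z = g p (D X Y p) (Z p) - g p (D' X Y p) (Z p)" for X Y Z
  have sym: "b X Y Z = b Y X Z" if v: "X \<in> vfields A" "Y \<in> vfields A" "Z \<in> vfields A" for X Y Z
  proof -
    have "D X Y p - D Y X p = D' X Y p - D' Y X p"
      using D D' v by (simp add: is_levi_civita_def torsion_def fun_eq_iff)
    moreover have "b X Y Z - b Y X Z =
        g p (D X Y p - D Y X p) (Z p) - g p (D' X Y p - D' Y X p) (Z p)"
      using v by (simp add: b_def g_diff_left vfields_tangent vf)
    ultimately show ?thesis by simp
  qed
  have skew: "b X Y Z = - b X Z Y" if v: "X \<in> vfields A" "Y \<in> vfields A" "Z \<in> vfields A" for X Y Z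
  proof -
    have "X p (\<lambda>q. g q (Y q) (Z q)) = g p (D X Y p) (Z p) + g p (Y p) (D X Z p)"
      using D v by (simp add: is_levi_civita_def metric_parallel_def)
    moreover have "X p (\<lambda>q. g q (Y q) (Z q)) = g p (D' X Y p) (Z p) + g p (Y p) (D' X Z p)"
      using D' v by (simp add: is_levi_civita_def metric_parallel_def)
    moreover have "g p (Y p) (D X Z p) = g p (D X Z p) (Y p)"
        "g p (Y p) (D' X Z p) = g p (D' X Z p) (Y p)"
      using v vf by (meson g_sym vfields_tangent)+
    ultimately show ?thesis by (simp add: b_def)
  qed
  \<comment> \<open>Alternating the two transpositions six times returns to \<open>b X Y Z\<close>;
    the three skew ones contribute the sign -1.\<close>
  have "b X Y Z = 0"
    using sym[OF X Y Z] skew[OF Y X Z] sym[OF Y Z X] skew[OF Z Y X] sym[OF Z X Y] skew[OF X Z Y] by simp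
  then show "g p (D X Y p) (Z p) = g p (D' X Y p) (Z p)" by (simp add: b_def)
qed

end

section \<open>The Levi-Civita connection of a metric connection with skew torsion\<close>

locale skew_torsion = riemannian_manifold A g
  for A :: "('a::{t2_space,second_countable_topology}, 'e::euclidean_space) atlas"
    and g :: "'a metric_field" +
  fixes D :: "'a connection"
  assumes connection: "connection A D" and metric_parallel: "metric_parallel A g D"
    and torsion_skew_right: "X \<in> vfields A \<Longrightarrow> Y \<in> vfields A \<Longrightarrow> Z \<in> vfields A \<Longrightarrow>
       g p (torsion A D X Y p) (Z p) = - g p (torsion A D X Z p) (Y p)"
begin

abbreviation T where "T \<equiv> torsion A D"

lemma connection_vfields: "X \<in> vfields A \<Longrightarrow> Y \<in> vfields A \<Longrightarrow> D X Y \<in> vfields A"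
  using connection by (simp add: connection_def)

lemma torsion_vfields: "X \<in> vfields A \<Longrightarrow> Y \<in> vfields A \<Longrightarrow> T X Y \<in> vfields A"
  by (simp add: torsion_def vfields_diff connection_vfields lie_bracket_vfields)

lemma torsion_skew: "T X Y = - T Y X"
  using lie_bracket_skew[of X Y] by (simp add: torsion_def)

lemma torsion_skew_left:
  assumes "X \<in> vfields A" "Y \<in> vfields A" "Z \<in> vfields A"
  shows "g p (T X Y p) (Z p) = - g p (T Y X p) (Z p)"
proof -
  have "T X Y p = - T Y X p" using torsion_skew[of X Y] by simp
  then show ?thesis using assms by (simp add: g_minus_left vfields_tangent torsion_vfields)
qed

lemma torsion_add_left:
  assumes "X \<in> vfields A" "Y \<in> vfields A" "Z \<in> vfields A"
  shows "T (X + Y) Z = T X Z + T Y Z"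
  using connection assms by (simp add: torsion_def connection_def lie_bracket_add_left)

lemma torsion_add_right:
  assumes "X \<in> vfields A" "Y \<in> vfields A" "Z \<in> vfields A"
  shows "T X (Y + Z) = T X Y + T X Z"
  using torsion_add_left[OF assms(2,3,1)] torsion_skew[of X "Y + Z"] torsion_skew[of X Y] torsion_skew[of X Z]
  by simp

text \<open>The derivative term of \<open>D Y (f X)\<close> is cancelled by that of the bracket.
  Tensoriality of \<open>T\<close> is what keeps \<open>D - T/2\<close> a connection.\<close>

lemma torsion_fun_left:
  assumes "X \<in> vfields A" "Y \<in> vfields A" "f \<in> smooth_funs A"
  shows "T (\<lambda>p. f p *\<^sub>R X p) Y = (\<lambda>p. f p *\<^sub>R T X Y p)"
  using connection assms
  by (simp add: torsion_def connection_def lie_bracket_fun_left) (simp add: fun_eq_iff scaleR_fun_def algebra_simps)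

lemma torsion_fun_right:
  assumes "X \<in> vfields A" "Y \<in> vfields A" "f \<in> smooth_funs A"
  shows "T X (\<lambda>p. f p *\<^sub>R Y p) = (\<lambda>p. f p *\<^sub>R T X Y p)"
  using torsion_fun_left[OF assms(2,1,3)] torsion_skew[of X Y] torsion_skew[of X "\<lambda>p. f p *\<^sub>R Y p"]
  by (simp add: fun_eq_iff scaleR_fun_def)

text \<open>Skewness in the first two slots makes the correction -T/2 remove the whole torsion;
  skewness in the last two makes it a skew endomorphism, which preserves the metric.\<close>

lemma is_levi_civita: "is_levi_civita A g (\<lambda>X Y. D X Y - (1/2) *\<^sub>R T X Y)"
  (is "is_levi_civita A g ?N")
  unfolding is_levi_civita_def
proof (intro conjI ballI)
  show "connection A ?N"
    using connection
    by (simp add: connection_def vfields_diff vfields_scale torsion_vfields torsion_add_left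
        torsion_add_right torsion_fun_left torsion_fun_right)
      (simp add: fun_eq_iff scaleR_fun_def algebra_simps)
  show "metric_parallel A g ?N"
    unfolding metric_parallel_def
  proof (intro ballI allI)
    fix X Y Z p assume v: "X \<in> vfields A" "Y \<in> vfields A" "Z \<in> vfields A"
    have "g p (Y p) (T X Z p) = g p (T X Z p) (Y p)"
      using v by (meson g_sym vfields_tangent torsion_vfields)
    moreover have "X p (\<lambda>q. g q (Y q) (Z q)) = g p (D X Y p) (Z p) + g p (Y p) (D X Z p)"
      using metric_parallel v by (simp add: metric_parallel_def)
    moreover have "((1/2) *\<^sub>R W) p = (1/2) *\<^sub>R W p" for W :: "'a vfield"
      by (simp add: scaleR_fun_def)
    ultimately show "X p (\<lambda>q. g q (Y q) (Z q)) = g p (?N X Y p) (Z p) + g p (Y p) (?N X Z p)"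
      using v torsion_skew_right[OF v, of p]
      by (simp add: g_bilinear vfields_tangent tangent_closed torsion_vfields connection_vfields)
  qed
  fix X Y
  show "torsion A ?N X Y = 0"
    using lie_bracket_skew[of X Y]
    by (simp add: torsion_def fun_eq_iff scaleR_fun_def field_simps)
qed

lemma levi_civita_eq:
  assumes "X \<in> vfields A" "Y \<in> vfields A"
  shows "levi_civita A g X Y = D X Y - (1/2) *\<^sub>R T X Y"
  unfolding levi_civita_def
  by (rule levi_civita_unique[OF someI[of "is_levi_civita A g", OF is_levi_civita] is_levi_civita assms])

end

section \<open>Algebra of an orthogonal almost complex structure\<close>

locale almost_hermitian_manifold = riemannian_manifold A g
  for A :: "('a::{t2_space,second_countable_topology}, 'e::euclidean_space) atlas"
    and g :: "'a metric_field" +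
  fixes J :: "'a endo_field"
  assumes almost_hermitian: "almost_hermitian A g J"
begin

context
  fixes p u
  assumes u: "u \<in> tangent_space A p"
begin

lemma J_tangent: "J p u \<in> tangent_space A p"
  using almost_hermitian u by (simp add: almost_hermitian_def almost_complex_def)

lemma J_add: "v \<in> tangent_space A p \<Longrightarrow> J p (u + v) = J p u + J p v"
  using almost_hermitian u by (simp add: almost_hermitian_def almost_complex_def)

lemma J_scale: "J p (c *\<^sub>R u) = c *\<^sub>R J p u"
  using almost_hermitian u by (simp add: almost_hermitian_def almost_complex_def)

lemma J_J: "J p (J p u) = - u"
  using almost_hermitian u by (simp add: almost_hermitian_def almost_complex_def)

lemma g_J_J: "v \<in> tangent_space A p \<Longrightarrow> g p (J p u) (J p v) = g p u v"
  using almost_hermitian u by (simp add: almost_hermitian_def)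

end

lemma J_minus: "u \<in> tangent_space A p \<Longrightarrow> J p (- u) = - J p u"
  using J_scale[of u p "-1"] by simp

lemma J_diff: "u \<in> tangent_space A p \<Longrightarrow> v \<in> tangent_space A p \<Longrightarrow> J p (u - v) = J p u - J p v"
  using J_add[of u p "-v"] by (simp add: J_minus tangent_minus)

text \<open>An isometry with square -1 is skew-adjoint: apply invariance of \<open>g\<close> to
  \<open>u\<close> and \<open>J p v\<close>.\<close>

lemma g_J_left:
  assumes "u \<in> tangent_space A p" "v \<in> tangent_space A p"
  shows "g p (J p u) v = - g p u (J p v)"
  using g_J_J[OF assms(1) J_tangent[OF assms(2)]] assms by (simp add: J_J g_minus_right J_tangent)

lemma app_vfields_on: "open S \<Longrightarrow> X \<in> vfields_on A S \<Longrightarrow> app J X \<in> vfields_on A S"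
  using almost_hermitian by (simp add: almost_hermitian_def almost_complex_def)

lemmas app_vfields = app_vfields_on[OF open_UNIV]

lemma app_diff: "X \<in> vfields A \<Longrightarrow> Y \<in> vfields A \<Longrightarrow> app J (X - Y) = app J X - app J Y"
  by (simp add: app_def fun_eq_iff J_diff vfields_tangent)

lemma app_scale: "X \<in> vfields A \<Longrightarrow> app J (c *\<^sub>R X) = c *\<^sub>R app J X"
  \<comment> \<open>Vector fields and tangent vectors are both functions. The type instance unfolds
    scaling over the points only, leaving scaling of tangent vectors for
    \<open>J_scale\<close>.\<close>
  by (simp add: app_def scaleR_fun_def[where 'a = 'a] J_scale vfields_tangent)

lemma app_app: "X \<in> vfields A \<Longrightarrow> app J (app J X) = - X"
  by (simp add: app_def fun_eq_iff J_J vfields_tangent)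

end

section \<open>Hermitian connections with skew torsion\<close>

locale skew_torsion_hermitian = almost_hermitian_manifold A g J + skew_torsion A g D
  for A :: "('a::{t2_space,second_countable_topology}, 'e::euclidean_space) atlas"
    and g :: "'a metric_field" and J :: "'a endo_field" and D :: "'a connection" +
  assumes J_parallel: "X \<in> vfields A \<Longrightarrow> Y \<in> vfields A \<Longrightarrow> D X (app J Y) = app J (D X Y)"
begin

lemma cov_deriv_levi_civita:
  assumes "X \<in> vfields A" "Y \<in> vfields A"
  shows "cov_deriv_endo (levi_civita A g) J X Y = (1/2) *\<^sub>R (app J (T X Y) - T X (app J Y))"
  using assms
  by (simp add: cov_deriv_endo_def levi_civita_eq app_vfields J_parallel app_diff app_scale
      connection_vfields vfields_scale torsion_vfields scaleR_diff_right)

text \<open>Under \<open>anti\<close> the derivative of \<open>J\<close> is J T(X,Y), so -1/2 J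
  (\<nabla> J) equals T/2 and undoes the -T/2 that separates \<open>levi_civita\<close> from
  \<open>D\<close>.\<close>

lemma nearly_kahler_and_canonical:
  assumes anti: "\<And>X Y. X \<in> vfields A \<Longrightarrow> Y \<in> vfields A \<Longrightarrow> T X (app J Y) = - app J (T X Y)"
  shows "nearly_kahler A g J"
    and "X \<in> vfields A \<Longrightarrow> Y \<in> vfields A \<Longrightarrow> canonical_connection A g J X Y = D X Y"
proof -
  have nabla_J: "cov_deriv_endo (levi_civita A g) J X Y = app J (T X Y)"
    if "X \<in> vfields A" "Y \<in> vfields A" for X Y
    using that by (simp add: cov_deriv_levi_civita anti) (simp add: fun_eq_iff scaleR_fun_def)
  have "app J (T X X) = 0" if "X \<in> vfields A" for X
  proof -
    have "2 *\<^sub>R T X X = 0"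
      using torsion_skew[of X X] unfolding scaleR_2 by (metis add.right_inverse)
    \<comment> \<open>Writing zero as a multiple of \<open>X\<close> makes
      \<open>app J 0 = 0\<close> an instance of linearity.\<close>
    then have "T X X = 0 *\<^sub>R X" by simp
    then show ?thesis using app_scale[OF that, of 0] by simp
  qed
  then show "nearly_kahler A g J"
    using almost_hermitian by (simp add: nearly_kahler_def nabla_J)
  assume v: "X \<in> vfields A" "Y \<in> vfields A"
  then show "canonical_connection A g J X Y = D X Y"
    by (simp add: canonical_connection_def nabla_J app_app torsion_vfields levi_civita_eq)
qed

text \<open>Replace each bracket by its expression through \<open>D\<close> and \<open>T\<close>. As
  \<open>J\<close> commutes with \<open>D\<close> and squares to -1, the eight terms containing
  \<open>D\<close> cancel in pairs.\<close>

lemma nijenhuis_torsion: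
  assumes X: "X \<in> vfields A" and Y: "Y \<in> vfields A"
  shows "nijenhuis A J X Y =
    T X Y - T (app J X) (app J Y) + app J (T (app J X) Y) + app J (T X (app J Y))"
proof -
  have bracket: "lie_bracket A U W = D U W - D W U - T U W" for U W
    by (simp add: torsion_def)
  show ?thesis
    using assms
    by (simp add: nijenhuis_def bracket J_parallel app_diff app_app app_vfields connection_vfields
        torsion_vfields vfields_diff)
qed

lemma skew_torsion_connection: "skew_torsion_connection A g J D"
  unfolding skew_torsion_connection_def
proof (intro conjI ballI allI connection metric_parallel torsion_skew_left torsion_skew_right)
  show "cov_deriv_endo D J X Y = 0" if "X \<in> vfields A" "Y \<in> vfields A" for X Y
    using that by (simp add: cov_deriv_endo_def J_parallel)
qed

end

lemma (in almost_hermitian_manifold) skew_torsion_hermitianI: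
  assumes "skew_torsion_connection A g J D"
  shows "skew_torsion_hermitian A g J D"
proof unfold_locales
  note D = assms[unfolded skew_torsion_connection_def]
  show "connection A D" "metric_parallel A g D"
    using D by simp_all
  show "g p (torsion A D X Y p) (Z p) = - g p (torsion A D X Z p) (Y p)"
    if "X \<in> vfields A" "Y \<in> vfields A" "Z \<in> vfields A" for X Y Z p
    using D[THEN conjunct2, THEN conjunct2, THEN conjunct2] that by blast
  show "D X (app J Y) = app J (D X Y)" if "X \<in> vfields A" "Y \<in> vfields A" for X Y
    using D[THEN conjunct2, THEN conjunct2, THEN conjunct1] that by (simp add: cov_deriv_endo_def)
qed

lemma (in skew_torsion_hermitian) skew_torsion_connection_unique:
  assumes "skew_torsion_connection A g J D'" and X: "X \<in> vfields A" and Y: "Y \<in> vfields A"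
  shows "D' X Y = D X Y"
proof -
  interpret D': skew_torsion_hermitian A g J D'
    using assms(1) by (rule skew_torsion_hermitianI)
  note closed = vfields_tangent torsion_vfields D'.torsion_vfields app_vfields
  define s where "s X Y Z p = g p (T X Y p) (Z p) - g p (D'.T X Y p) (Z p)" for X Y Z p
  have skew_left: "s X Y Z p = - s Y X Z p" and skew_right: "s X Y Z p = - s X Z Y p"
    if "X \<in> vfields A" "Y \<in> vfields A" "Z \<in> vfields A" for X Y Z p
    using that torsion_skew_left[of X Y Z p] D'.torsion_skew_left[of X Y Z p]
      torsion_skew_right[of X Y Z p] D'.torsion_skew_right[of X Y Z p] by (simp_all add: s_def)
  have s_J: "s X (app J Y) Z p = - s X Y (app J Z) p"
    if v: "X \<in> vfields A" "Y \<in> vfields A" "Z \<in> vfields A" for X Y Z p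
  proof -
    \<comment> \<open>Both sides are the derivative of \<open>J\<close> under the common Levi-Civita
      connection.\<close>
    have "(1/2) *\<^sub>R (app J (T X Y) - T X (app J Y)) = (1/2) *\<^sub>R (app J (D'.T X Y) - D'.T X (app J Y))"
      using cov_deriv_levi_civita[of X Y] D'.cov_deriv_levi_civita[of X Y] v by simp
    then have "app J (T X Y) - T X (app J Y) = app J (D'.T X Y) - D'.T X (app J Y)"
      by simp
    then have "J p (T X Y p) - T X (app J Y) p = J p (D'.T X Y p) - D'.T X (app J Y) p"
      by (simp add: fun_eq_iff app_def)
    then have "g p (J p (T X Y p) - T X (app J Y) p) (Z p) =
        g p (J p (D'.T X Y p) - D'.T X (app J Y) p) (Z p)"
      by simp
    then show ?thesis
      using v by (simp add: s_def g_diff_left closed J_tangent g_J_left app_def[of J Z])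
  qed
  \<comment> \<open>The chain carries \<open>J\<close> from \<open>Z\<close> to \<open>Y\<close>,
    then to \<open>X\<close> and back to \<open>Z\<close>. Each of the three moves costs a sign, so
    the value equals its own negative.\<close>
  have zero: "s X Y (app J Z) p = 0"
    if v: "X \<in> vfields A" "Y \<in> vfields A" "Z \<in> vfields A" for X Y Z p
  proof -
    have "s X Y (app J Z) p = - s X (app J Y) Z p"
      using s_J[OF v] by simp
    also have "\<dots> = s (app J Y) X Z p"
      using skew_left[OF app_vfields[OF v(2)] v(1,3)] by simp
    also have "\<dots> = - s (app J Y) Z X p"
      using skew_right[OF app_vfields[OF v(2)] v(1,3)] by simp
    also have "\<dots> = s Z (app J Y) X p"
      using skew_left[OF v(3) app_vfields[OF v(2)] v(1)] by simp
    also have "\<dots> = - s Z Y (app J X) p"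
      using s_J[OF v(3,2,1)] by simp
    also have "\<dots> = s Y Z (app J X) p"
      using skew_left[OF v(2,3) app_vfields[OF v(1)]] by simp
    also have "\<dots> = - s Y (app J Z) X p"
      using s_J[OF v(2,3,1)] by simp
    also have "\<dots> = s Y X (app J Z) p"
      using skew_right[OF v(2,1) app_vfields[OF v(3)]] by simp
    also have "\<dots> = - s X Y (app J Z) p"
      using skew_left[OF v(2,1) app_vfields[OF v(3)]] by simp
    finally show ?thesis by simp
  qed
  have "T X Y = D'.T X Y"
  proof (rule vfields_eqI)
    fix Z p assume Z: "Z \<in> vfields A"
    \<comment> \<open>Every \<open>Z\<close> is of the form \<open>app J\<close> of a field, namely
      of \<open>- app J Z\<close>, so the vanishing covers all third arguments.\<close>
    have "s X Y (app J (- app J Z)) p = 0"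
      by (rule zero[OF X Y vfields_minus[OF app_vfields[OF Z]]])
    moreover have "app J (- app J Z) = Z"
      using app_scale[OF app_vfields[OF Z], of "-1"] Z by (simp add: app_app)
    ultimately show "g p (T X Y p) (Z p) = g p (D'.T X Y p) (Z p)" by (simp add: s_def)
  qed (use X Y closed in auto)
  then show ?thesis
    using levi_civita_eq[OF X Y] D'.levi_civita_eq[OF X Y] by simp
qed

section \<open>Orthogonal splittings\<close>

text \<open>Strict Cauchy-Schwarz. The vector \<open>w\<close> is \<open>g p v v\<close> times the
  component of \<open>u\<close> orthogonal to \<open>v\<close>, and its squared length is
  \<open>g p v v\<close> times the determinant.\<close>

lemma (in riemannian_manifold) gram_pos:
  assumes t: "u \<in> tangent_space A p" "v \<in> tangent_space A p"
    and "v \<noteq> 0" "\<And>c. u \<noteq> c *\<^sub>R v"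
  shows "g p u u * g p v v - g p u v * g p u v > 0"
proof -
  define w where "w = g p v v *\<^sub>R u - g p u v *\<^sub>R v"
  have vv: "g p v v > 0" using g_pos t assms(3) by blast
  have "w \<noteq> 0"
  proof
    assume "w = 0"
    then have "inverse (g p v v) *\<^sub>R (g p v v *\<^sub>R u) = inverse (g p v v) *\<^sub>R (g p u v *\<^sub>R v)"
      by (simp add: w_def)
    then have "u = (inverse (g p v v) * g p u v) *\<^sub>R v" using vv by simp
    then show False using assms(4) by blast
  qed
  moreover have wT: "w \<in> tangent_space A p" using t by (simp add: w_def tangent_closed)
  ultimately have "0 < g p w w" by (rule g_pos[rotated])
  also have "g p w w = g p v v * (g p u u * g p v v - g p u v * g p u v)"
    using t g_sym[OF t] by (simp add: w_def g_bilinear tangent_closed algebra_simps)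
  finally show ?thesis using vv by (simp add: zero_less_mult_iff)
qed

section \<open>The twisted structure of an orthogonal splitting\<close>

locale hermitian_splitting = almost_hermitian_manifold A g J
  for A :: "('a::{t2_space,second_countable_topology}, 'e::euclidean_space) atlas"
    and g :: "'a metric_field" and J :: "'a endo_field" +
  fixes H V :: "'a distribution"
  assumes subspace_H: "subspace (H p)" and H_tangent: "h \<in> H p \<Longrightarrow> h \<in> tangent_space A p"
    and subbundle_V: "subbundle A 2 V"
    and disjoint: "H p \<inter> V p = {0}"
    and sum: "{h + w | h w. h \<in> H p \<and> w \<in> V p} = tangent_space A p"
    and orthogonal: "h \<in> H p \<Longrightarrow> w \<in> V p \<Longrightarrow> g p h w = 0"
    and J_H: "h \<in> H p \<Longrightarrow> J p h \<in> H p" and J_V: "w \<in> V p \<Longrightarrow> J p w \<in> V p"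
begin

abbreviation K where "K \<equiv> J_hat J H V"

lemma subspace_V: "subspace (V p)"
  using subbundle_V by (simp add: subbundle_def)

lemma V_tangent: "w \<in> V p \<Longrightarrow> w \<in> tangent_space A p"
  using subbundle_V by (auto simp: subbundle_def)

lemma orthogonal': "w \<in> V p \<Longrightarrow> h \<in> H p \<Longrightarrow> g p w h = 0"
  using orthogonal g_sym H_tangent V_tangent by metis

lemma splitE:
  assumes "u \<in> tangent_space A p"
  obtains h w where "h \<in> H p" "w \<in> V p" "u = h + w"
  using assms sum[of p] by blast

text \<open>Justifies the definite description: two decompositions of the same vector differ by an
  element of \<open>H p \<inter> V p\<close>, which is zero.\<close>

lemma J_hat_eq:
  assumes "h \<in> H p" "w \<in> V p"
  shows "K p (h + w) = J p h - J p w"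
  unfolding J_hat_def
proof (rule the_equality)
  show "\<exists>h'\<in>H p. \<exists>w'\<in>V p. h + w = h' + w' \<and> J p h - J p w = J p h' - J p w'"
    using assms by blast
  fix u assume "\<exists>h'\<in>H p. \<exists>w'\<in>V p. h + w = h' + w' \<and> u = J p h' - J p w'"
  then obtain h' w' where *: "h' \<in> H p" "w' \<in> V p" "h + w = h' + w'" "u = J p h' - J p w'"
    by blast
  then have eq: "h - h' = w' - w" by (simp add: algebra_simps)
  have "h - h' \<in> H p" "w' - w \<in> V p"
    using * assms subspace_diff subspace_H subspace_V by blast+
  then have "h - h' \<in> H p \<inter> V p" using eq by simp
  then have "h - h' = 0" using disjoint by blast
  then have "h = h'" "w = w'" using eq by auto
  then show "u = J p h - J p w" using *(4) by simp
qed

lemma J_hat_tangent: "u \<in> tangent_space A p \<Longrightarrow> K p u \<in> tangent_space A p"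
  by (elim splitE) (simp add: J_hat_eq tangent_diff J_tangent H_tangent V_tangent)

lemma J_hat_add:
  assumes "u \<in> tangent_space A p" "v \<in> tangent_space A p"
  shows "K p (u + v) = K p u + K p v"
proof -
  obtain h w where 1: "h \<in> H p" "w \<in> V p" "u = h + w" using assms(1) by (rule splitE)
  obtain h' w' where 2: "h' \<in> H p" "w' \<in> V p" "v = h' + w'" using assms(2) by (rule splitE)
  have "u + v = (h + h') + (w + w')" using 1 2 by (simp add: algebra_simps)
  moreover have "h + h' \<in> H p" "w + w' \<in> V p"
    using 1 2 subspace_add subspace_H subspace_V by blast+
  ultimately have "K p (u + v) = J p (h + h') - J p (w + w')" by (simp add: J_hat_eq)
  then show ?thesis
    using 1 2 by (simp add: J_hat_eq J_add H_tangent V_tangent)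
qed

lemma J_hat_scale:
  assumes "u \<in> tangent_space A p"
  shows "K p (c *\<^sub>R u) = c *\<^sub>R K p u"
proof -
  obtain h w where 1: "h \<in> H p" "w \<in> V p" "u = h + w" using assms by (rule splitE)
  have "c *\<^sub>R h \<in> H p" "c *\<^sub>R w \<in> V p"
    using 1 subspace_scale subspace_H subspace_V by blast+
  then have "K p (c *\<^sub>R h + c *\<^sub>R w) = J p (c *\<^sub>R h) - J p (c *\<^sub>R w)" by (rule J_hat_eq)
  then show ?thesis
    using 1 by (simp add: J_hat_eq J_scale H_tangent V_tangent scaleR_right_distrib scaleR_diff_right)
qed

lemma J_hat_J_hat:
  assumes "u \<in> tangent_space A p"
  shows "K p (K p u) = - u"
proof -
  obtain h w where 1: "h \<in> H p" "w \<in> V p" "u = h + w" using assms by (rule splitE)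
  \<comment> \<open>K u = J h - J w must again be displayed as a sum of an H-vector and a V-vector
    before \<open>J_hat_eq\<close> can be applied a second time.\<close>
  have "- J p w \<in> V p" using 1 J_V subspace_V subspace_neg by blast
  with 1 have "K p (J p h + (- J p w)) = J p (J p h) - J p (- J p w)"
    by (intro J_hat_eq J_H)
  then show ?thesis
    using 1 by (simp add: J_hat_eq J_minus J_J J_tangent H_tangent V_tangent)
qed

lemma g_J_hat_J_hat:
  assumes "u \<in> tangent_space A p" "v \<in> tangent_space A p"
  shows "g p (K p u) (K p v) = g p u v"
proof -
  obtain h w where 1: "h \<in> H p" "w \<in> V p" "u = h + w" using assms(1) by (rule splitE)
  obtain h' w' where 2: "h' \<in> H p" "w' \<in> V p" "v = h' + w'" using assms(2) by (rule splitE)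
  show ?thesis
    using 1 2 J_H[OF 1(1)] J_H[OF 2(1)] J_V[OF 1(2)] J_V[OF 2(2)]
    by (simp add: J_hat_eq g_bilinear tangent_closed J_tangent H_tangent V_tangent orthogonal
        orthogonal' g_J_J)
qed

text \<open>A rank two frame of V is not orthonormal; Cramer's rule for its Gram matrix expresses the
  V-component through smooth functions.\<close>

lemma smooth_projection:
  assumes S: "open S" and X: "X \<in> vfields_on A S"
  obtains W where "W \<in> vfields_on A S" "\<And>p. p \<in> S \<Longrightarrow> W p \<in> V p" "\<And>p. p \<in> S \<Longrightarrow> X p - W p \<in> H p"
proof -
  \<comment> \<open>The V-component is picked point by point; its smoothness is derived afterwards
    from a formula in a local frame.\<close>
  have "\<exists>w. w \<in> V p \<and> X p - w \<in> H p" if "p \<in> S" for p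
    using splitE[OF vfields_onD[OF X that]] by (metis add_diff_cancel_right')
  then obtain W where W: "\<And>p. p \<in> S \<Longrightarrow> W p \<in> V p" "\<And>p. p \<in> S \<Longrightarrow> X p - W p \<in> H p"
    by metis
  have "smooth_fun_on A S (\<lambda>p. W p f)" if f: "f \<in> smooth_funs A" for f
  proof (rule smooth_fun_on_locally)
    fix p0 assume "p0 \<in> S"
    obtain S' and E :: "nat \<Rightarrow> 'a vfield" where S': "open S'" "p0 \<in> S'"
      and E: "\<forall>i<2. E i \<in> vfields_on A S'"
      and frame: "\<forall>q\<in>S'. inj_on (\<lambda>i. E i q) {..<2} \<and>
        independent ((\<lambda>i. E i q) ` {..<2}) \<and> span ((\<lambda>i. E i q) ` {..<2}) = V q"
      using subbundle_V[unfolded subbundle_def, THEN conjunct2, THEN spec, of p0]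
      by (elim exE conjE)
    define B where "B = S \<inter> S'"
    have B: "open B" "p0 \<in> B" "B \<subseteq> S" "B \<subseteq> S'"
      using S S' \<open>p0 \<in> S\<close> by (auto simp: B_def)
    have vf: "E 0 \<in> vfields_on A B" "E 1 \<in> vfields_on A B" "X \<in> vfields_on A B"
      using E[rule_format, of 0] E[rule_format, of 1] X B(3,4) by (auto intro: vfields_on_subset)
    \<comment> \<open>\<open>G\<close> is the Gram determinant of the frame, \<open>a\<close> and
      \<open>b\<close> the Cramer numerators. If W = c E0 + d E1, then a = c G and b = d G.\<close>
    define G where "G p = g p (E 0 p) (E 0 p) * g p (E 1 p) (E 1 p)
      - g p (E 0 p) (E 1 p) * g p (E 0 p) (E 1 p)" for p
    define a where "a p = g p (X p) (E 0 p) * g p (E 1 p) (E 1 p)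
      - g p (X p) (E 1 p) * g p (E 0 p) (E 1 p)" for p
    define b where "b p = g p (X p) (E 1 p) * g p (E 0 p) (E 0 p)
      - g p (X p) (E 0 p) * g p (E 0 p) (E 1 p)" for p
    have G_pos: "G p > 0" and cramer: "inverse (G p) * (a p * E 0 p f + b p * E 1 p f) = W p f"
      if p: "p \<in> B" for p
    proof -
      have t: "E 0 p \<in> tangent_space A p" "E 1 p \<in> tangent_space A p" "X p \<in> tangent_space A p"
        using vf p by (auto intro: vfields_onD)
      have img: "(\<lambda>i. E i p) ` {..<2} = {E 0 p, E 1 p}"
        by (auto simp: numeral_2_eq_2 lessThan_Suc)
      have F: "inj_on (\<lambda>i. E i p) {..<2}" "independent ((\<lambda>i. E i p) ` {..<2})"
          "span ((\<lambda>i. E i p) ` {..<2}) = V p"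
        using frame p B(4) by blast+
      have fr: "E 0 p \<noteq> E 1 p" "independent {E 0 p, E 1 p}" "span {E 0 p, E 1 p} = V p"
        using F(2,3) inj_onD[OF F(1), of 0 1] by (auto simp: img)
      then have "E 1 p \<noteq> 0" "E 0 p \<notin> span {E 1 p}"
        by (auto simp: independent_insert)
      then have "E 0 p \<noteq> c *\<^sub>R E 1 p" for c
        by (auto simp: span_singleton)
      with \<open>E 1 p \<noteq> 0\<close> show "G p > 0"
        unfolding G_def using t(1,2) by (intro gram_pos)
      have "W p \<in> span {E 0 p, E 1 p}" using W(1) p B(3) fr(3) by auto
      then obtain c d where cd: "W p = c *\<^sub>R E 0 p + d *\<^sub>R E 1 p"
        by (auto simp: span_insert span_singleton) (metis add.commute diff_eq_eq)
      have "E 0 p \<in> V p" "E 1 p \<in> V p"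
        using fr(3) span_superset[of "{E 0 p, E 1 p}"] by auto
      \<comment> \<open>Since \<open>X - W\<close> lies in H, orthogonal to the frame, the unknown
        products of \<open>W\<close> with the frame are those of \<open>X\<close>, which are
        smooth.\<close>
      then have *: "g p (X p) (E i p) = g p (W p) (E i p)" if "i = 0 \<or> i = 1" for i
        using orthogonal[OF W(2), of p "E i p"] W(1)[of p] t that p B(3)
        by (auto simp: g_diff_left V_tangent)
      have sym: "g p (E 1 p) (E 0 p) = g p (E 0 p) (E 1 p)" using t g_sym by blast
      have x0: "g p (X p) (E 0 p) = c * g p (E 0 p) (E 0 p) + d * g p (E 0 p) (E 1 p)"
        and x1: "g p (X p) (E 1 p) = c * g p (E 0 p) (E 1 p) + d * g p (E 1 p) (E 1 p)"
        using *[of 0] *[of 1] t sym by (simp_all add: cd g_bilinear tangent_closed)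
      have "a p = c * G p" "b p = d * G p"
        unfolding a_def b_def x0 x1 G_def by (simp_all add: algebra_simps)
      then show "inverse (G p) * (a p * E 0 p f + b p * E 1 p f) = W p f"
        using \<open>G p > 0\<close> by (simp add: cd scaleR_fun_def field_simps)
    qed
    note mult = smooth_fun_on_mult[OF B(1)]
    have gs: "smooth_fun_on A B (\<lambda>p. g p (Y p) (Z p))"
      if "Y \<in> {E 0, E 1, X}" "Z \<in> {E 0, E 1, X}" for Y Z
      using that vf g_smooth[OF B(1)] by blast
    have "smooth_fun_on A B G" "smooth_fun_on A B a" "smooth_fun_on A B b"
      unfolding G_def a_def b_def by (intro smooth_fun_on_diff[OF B(1)] mult gs; simp)+
    moreover from this(1) have "smooth_fun_on A B (\<lambda>p. inverse (G p))"
      by (rule smooth_fun_on_inverse[OF B(1)]) (use G_pos in force)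
    ultimately have "smooth_fun_on A B (\<lambda>p. inverse (G p) * (a p * E 0 p f + b p * E 1 p f))"
      using vf(1,2) f by (simp add: mult smooth_fun_on_add[OF B(1)] vfields_on_smooth)
    then have "smooth_fun_on A B (\<lambda>p. W p f)"
      by (rule smooth_fun_on_cong[OF B(1) cramer, rotated])
    then show "\<exists>S'. open S' \<and> p0 \<in> S' \<and> smooth_fun_on A S' (\<lambda>p. W p f)"
      using B by blast
  qed
  then have "W \<in> vfields_on A S"
    using W(1) by (simp add: vfields_on_def V_tangent)
  then show ?thesis using W that by blast
qed

text \<open>Expresses K through \<open>J\<close> and the V-component \<open>W\<close>; smoothness
  and parallelism then pass from \<open>J\<close> to K as soon as they hold for
  \<open>W\<close>.\<close>

lemma app_J_hat_eq:
  assumes "W p \<in> V p" "X p - W p \<in> H p"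
  shows "app K X p = app J (X - W) p - app J W p"
  using J_hat_eq[OF assms(2,1)] by (simp add: app_def)

lemma app_J_hat_vfields_on:
  assumes S: "open S" and X: "X \<in> vfields_on A S"
  shows "app K X \<in> vfields_on A S"
proof -
  obtain W where W: "W \<in> vfields_on A S" "\<And>p. p \<in> S \<Longrightarrow> W p \<in> V p"
      "\<And>p. p \<in> S \<Longrightarrow> X p - W p \<in> H p"
    using smooth_projection[OF assms] by blast
  have "app J (X - W) - app J W \<in> vfields_on A S"
    by (intro vfields_on_diff app_vfields_on S X W)
  then show ?thesis
    by (rule vfields_on_cong[OF S]) (simp add: app_J_hat_eq[of W] W)
qed

lemma almost_hermitian_J_hat: "almost_hermitian A g K"
  unfolding almost_hermitian_def almost_complex_def
  using metric by (simp add: J_hat_tangent J_hat_add J_hat_scale J_hat_J_hat g_J_hat_J_hat app_J_hat_vfields_on)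

sublocale hat: almost_hermitian_manifold A g K
  by unfold_locales (rule almost_hermitian_J_hat)

section \<open>Covectors on H and V as eigencovectors of the twisted structure\<close>

lemma covector_split:
  assumes "\<alpha> \<in> complex_covectors A p" "h \<in> H p" "w \<in> V p"
  shows "\<alpha> (h + w) = \<alpha> h + \<alpha> w" "\<alpha> (K p (h + w)) = \<alpha> (J p h) - \<alpha> (J p w)"
proof -
  show "\<alpha> (h + w) = \<alpha> h + \<alpha> w"
    using assms by (simp add: complex_covectors_def H_tangent V_tangent)
  have t: "J p h \<in> tangent_space A p" "J p w \<in> tangent_space A p"
    using assms by (simp_all add: J_tangent H_tangent V_tangent)
  \<comment> \<open>Covectors are known to respect sums and real multiples of tangent vectors, so
    the difference is rewritten in those terms.\<close>
  have "\<alpha> (J p h + (-1) *\<^sub>R J p w) = \<alpha> (J p h) + \<alpha> ((-1) *\<^sub>R J p w)"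
    using assms(1) t(1) tangent_scale[OF t(2)] unfolding complex_covectors_def by blast
  also have "\<alpha> ((-1) *\<^sub>R J p w) = (-1) *\<^sub>R \<alpha> (J p w)"
    using assms(1) t unfolding complex_covectors_def by blast
  also have "J p h + (-1) *\<^sub>R J p w = K p (h + w)"
    using assms by (simp add: J_hat_eq)
  finally show "\<alpha> (K p (h + w)) = \<alpha> (J p h) - \<alpha> (J p w)"
    by simp
qed

text \<open>These covectors see only the H-component, where K is \<open>J\<close>, so the eigenvalue
  relation extends from H to the whole tangent space.\<close>

lemma forms_H_J_hat:
  assumes "u \<in> tangent_space A p"
  shows "\<alpha> \<in> forms10 A J H V p \<Longrightarrow> \<alpha> (K p u) = \<i> * \<alpha> u"
    and "\<alpha> \<in> forms01 A J H V p \<Longrightarrow> \<alpha> (K p u) = - \<i> * \<alpha> u"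
proof -
  obtain h w where *: "h \<in> H p" "w \<in> V p" "u = h + w" using assms by (rule splitE)
  note split = covector_split[of \<alpha>, OF _ *(1,2)]
  show "\<alpha> \<in> forms10 A J H V p \<Longrightarrow> \<alpha> (K p u) = \<i> * \<alpha> u"
    using split *(1,2) J_V[OF *(2)] unfolding *(3) forms10_def by simp
  show "\<alpha> \<in> forms01 A J H V p \<Longrightarrow> \<alpha> (K p u) = - \<i> * \<alpha> u"
    using split *(1,2) J_V[OF *(2)] unfolding *(3) forms01_def by simp
qed

text \<open>Here only the V-component counts, where K is -J; hence the opposite eigenvalue.\<close>

lemma forms_V_J_hat:
  assumes "u \<in> tangent_space A p"
  shows "\<alpha> \<in> forms10 A J V H p \<Longrightarrow> \<alpha> (K p u) = - \<i> * \<alpha> u"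
    and "\<alpha> \<in> forms01 A J V H p \<Longrightarrow> \<alpha> (K p u) = \<i> * \<alpha> u"
proof -
  obtain h w where *: "h \<in> H p" "w \<in> V p" "u = h + w" using assms by (rule splitE)
  note split = covector_split[of \<alpha>, OF _ *(1,2)]
  show "\<alpha> \<in> forms10 A J V H p \<Longrightarrow> \<alpha> (K p u) = - \<i> * \<alpha> u"
    using split *(1,2) J_H[OF *(1)] unfolding *(3) forms10_def by simp
  show "\<alpha> \<in> forms01 A J V H p \<Longrightarrow> \<alpha> (K p u) = \<i> * \<alpha> u"
    using split *(1,2) J_H[OF *(1)] unfolding *(3) forms01_def by simp
qed

end

section \<open>Types of 3-forms\<close>

lemma cspan_induct [consumes 1, case_names zero step]:
  assumes "\<sigma> \<in> cspan S" "P 0"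
    "\<And>c \<tau> \<rho>. \<tau> \<in> S \<Longrightarrow> P \<rho> \<Longrightarrow> P ((\<lambda>x. c * \<tau> x) + \<rho>)"
  shows "P \<sigma>"
  using module.span_induct_alt[of "\<lambda>(c::complex) f x. c * f x" \<sigma> S P]
    assms vector_space_complex_fun module_iff_vector_space
  unfolding cspan_def by blast

text \<open>Stated for an abstract map \<open>k\<close> and scalar \<open>a\<close>, to be used with
  \<open>K p\<close> and either of i and -i.\<close>

lemma ext2_eigen:
  assumes "\<omega> \<in> ext2 L" and L: "\<And>\<alpha> v. \<alpha> \<in> L \<Longrightarrow> v \<in> U \<Longrightarrow> \<alpha> (k v) = a * \<alpha> v"
    and "x \<in> U" "y \<in> U"
  shows "\<omega> (k x, y) = a * \<omega> (x, y)" "\<omega> (x, k y) = a * \<omega> (x, y)"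
proof -
  have "\<omega> (k x, y) = a * \<omega> (x, y) \<and> \<omega> (x, k y) = a * \<omega> (x, y)"
    using assms(1) unfolding ext2_def
  proof (induction rule: cspan_induct)
    case (step c \<tau> \<rho>)
    then obtain \<alpha> \<beta> where "\<tau> = wedge11 \<alpha> \<beta>" "\<alpha> \<in> L" "\<beta> \<in> L" by blast
    then show ?case
      using step.IH assms(3,4) by (simp add: wedge11_def L) (simp add: algebra_simps)
  qed simp
  then show "\<omega> (k x, y) = a * \<omega> (x, y)" "\<omega> (x, k y) = a * \<omega> (x, y)" by auto
qed

text \<open>All three factors have eigenvalue \<open>a\<close>, so whichever slot receives
  \<open>k\<close>, each term of the wedge gains the same scalar. With \<open>a\<close> equal to i
  or -i this is type (3,0) or (0,3).\<close>

lemma tensor21_eigen_same: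
  assumes "\<sigma> \<in> tensor21 (ext2 L) M"
    and L: "\<And>\<alpha> v. \<alpha> \<in> L \<Longrightarrow> v \<in> U \<Longrightarrow> \<alpha> (k v) = a * \<alpha> v"
    and M: "\<And>\<gamma> v. \<gamma> \<in> M \<Longrightarrow> v \<in> U \<Longrightarrow> \<gamma> (k v) = a * \<gamma> v"
    and U: "x \<in> U" "y \<in> U" "z \<in> U"
  shows "\<sigma> (x, k y, z) = a * \<sigma> (x, y, z)" "\<sigma> (x, y, k z) = a * \<sigma> (x, y, z)"
proof -
  have "\<sigma> (x, k y, z) = a * \<sigma> (x, y, z) \<and> \<sigma> (x, y, k z) = a * \<sigma> (x, y, z)"
    using assms(1) unfolding tensor21_def
  proof (induction rule: cspan_induct)
    case (step c \<tau> \<rho>)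
    then obtain \<omega> \<gamma> where w: "\<tau> = wedge21 \<omega> \<gamma>" "\<omega> \<in> ext2 L" "\<gamma> \<in> M" by blast
    note eig = ext2_eigen[of \<omega> L U k a, OF w(2) L]
    show ?case
      using step.IH w by (simp add: wedge21_def eig M U) (simp add: algebra_simps)
  qed simp
  then show "\<sigma> (x, k y, z) = a * \<sigma> (x, y, z)" "\<sigma> (x, y, k z) = a * \<sigma> (x, y, z)" by auto
qed

text \<open>In each term one slot carries -a and two carry a. Applying \<open>k\<close> to the pair
  of equal slots gives a^2 = -1, to either mixed pair -a^2 = 1, and 1 = -1 + 1 + 1. This is the
  pairing of the vanishing Nijenhuis tensor with a third vector.\<close>

lemma tensor21_eigen_opposite:
  assumes "\<sigma> \<in> tensor21 (ext2 L) M" and a: "a * a = - 1"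
    and L: "\<And>\<alpha> v. \<alpha> \<in> L \<Longrightarrow> v \<in> U \<Longrightarrow> \<alpha> (k v) = a * \<alpha> v"
    and M: "\<And>\<gamma> v. \<gamma> \<in> M \<Longrightarrow> v \<in> U \<Longrightarrow> \<gamma> (k v) = - a * \<gamma> v"
    and U: "x \<in> U" "y \<in> U" "z \<in> U" and k: "\<And>v. v \<in> U \<Longrightarrow> k v \<in> U"
  shows "\<sigma> (x, y, z) = \<sigma> (k x, k y, z) + \<sigma> (k x, y, k z) + \<sigma> (x, k y, k z)"
  using assms(1) unfolding tensor21_def
proof (induction rule: cspan_induct)
  case (step c \<tau> \<rho>)
  then obtain \<omega> \<gamma> where w: "\<tau> = wedge21 \<omega> \<gamma>" "\<omega> \<in> ext2 L" "\<gamma> \<in> M" by blast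
  note eig = ext2_eigen[of \<omega> L U k a, OF w(2) L]
  have aa: "a * (a * t) = - t" for t
    using a by (simp flip: mult.assoc)
  show ?case
    using step.IH w
    by (simp add: wedge21_def eig M U k) (simp add: algebra_simps aa)
qed simp

section \<open>Parallel splittings and the twisted structure\<close>

locale parallel_hermitian_splitting =
  hermitian_splitting A g J H V + skew_torsion_hermitian A g J D
  for A :: "('a::{t2_space,second_countable_topology}, 'e::euclidean_space) atlas"
    and g :: "'a metric_field" and J :: "'a endo_field" and H V :: "'a distribution"
    and D :: "'a connection" +
  assumes parallel_H: "parallel_subbundle A D H" and parallel_V: "parallel_subbundle A D V"
begin

text \<open>Both components of \<open>Y\<close> are global sections, and \<open>D X\<close> keeps
  each in its subbundle, so differentiation commutes with the sign change on V.\<close>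

lemma J_hat_parallel:
  assumes X: "X \<in> vfields A" and Y: "Y \<in> vfields A"
  shows "D X (app K Y) = app K (D X Y)"
proof -
  obtain W where W: "W \<in> vfields A" "\<And>p. W p \<in> V p" "\<And>p. Y p - W p \<in> H p"
    using smooth_projection[OF open_UNIV Y] by auto
  have D_diff: "D X (P - Q) = D X P - D X Q" if "P \<in> vfields A" "Q \<in> vfields A" for P Q
  proof -
    have "D X ((P - Q) + Q) = D X (P - Q) + D X Q"
      using connection X that vfields_diff[OF that] unfolding connection_def by blast
    then show ?thesis by simp
  qed
  have sect: "D X (Y - W) \<in> sections A H" "D X W \<in> sections A V"
    using parallel_H parallel_V X W vfields_diff[OF Y W(1)]
    by (auto simp: parallel_subbundle_def sections_def)
  have "app K Y = app J (Y - W) - app J W"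
    using app_J_hat_eq[of W _ Y] W by (auto simp: fun_eq_iff)
  then have "D X (app K Y) = app J (D X (Y - W)) - app J (D X W)"
    using X Y W(1) by (simp add: D_diff app_vfields vfields_diff J_parallel)
  also have "\<dots> = app J (D X Y - D X W) - app J (D X W)"
    using Y W(1) by (simp add: D_diff)
  \<comment> \<open>By parallelism \<open>D X W\<close> is the V-component of
    \<open>D X Y\<close>.\<close>
  also have "\<dots> = app K (D X Y)"
    using app_J_hat_eq[of "D X W" _ "D X Y"] sect D_diff[OF Y W(1)]
    by (auto simp: fun_eq_iff sections_def)
  finally show ?thesis .
qed

sublocale hat: skew_torsion_hermitian A g K D
  by unfold_locales (rule J_hat_parallel)

lemma torsion_J_hat:
  assumes "torsion_in A g D (mixed_type A J H V)" and X: "X \<in> vfields A" and Y: "Y \<in> vfields A"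
  shows "T X (app K Y) = - app K (T X Y)"
proof (rule vfields_eqI)
  fix Z p assume Z: "Z \<in> vfields A"
  note t = vfields_tangent[OF X, of p] vfields_tangent[OF Y, of p] vfields_tangent[OF Z, of p]
  obtain \<tau> where \<tau>: "\<tau> \<in> mixed_type A J H V p"
    and val: "\<And>X Y Z. X \<in> vfields A \<Longrightarrow> Y \<in> vfields A \<Longrightarrow> Z \<in> vfields A \<Longrightarrow>
      \<tau> (X p, Y p, Z p) = complex_of_real (g p (T X Y p) (Z p))"
    using assms(1) unfolding torsion_in_def by blast
  obtain \<sigma> \<rho> where \<sigma>: "\<sigma> \<in> tensor21 (ext2 (forms10 A J H V p)) (forms01 A J V H p)"
    and \<rho>: "\<rho> \<in> tensor21 (ext2 (forms01 A J H V p)) (forms10 A J V H p)" and "\<tau> = \<sigma> + \<rho>"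
    using \<tau> unfolding mixed_type_def subspace_sum_def by blast
  note eig = tensor21_eigen_same[of \<sigma> _ _ "tangent_space A p" "K p" \<i>, OF \<sigma>]
    tensor21_eigen_same[of \<rho> _ _ "tangent_space A p" "K p" "-\<i>", OF \<rho>]
  \<comment> \<open>The eigenvalue is i on \<open>\<sigma>\<close> and -i on \<open>\<rho>\<close>,
    but in either case \<open>K p\<close> can be moved from the second slot to the third without
    change.\<close>
  have "\<tau> (X p, K p (Y p), Z p) = \<tau> (X p, Y p, K p (Z p))"
    using t by (simp add: \<open>\<tau> = \<sigma> + \<rho>\<close> eig forms_H_J_hat forms_V_J_hat)
  then have "g p (T X (app K Y) p) (Z p) = g p (T X Y p) (K p (Z p))"
    using val[OF X hat.app_vfields[OF Y] Z] val[OF X Y hat.app_vfields[OF Z]] by (simp add: app_def)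
  then show "g p (T X (app K Y) p) (Z p) = g p ((- app K (T X Y)) p) (Z p)"
    using X Y Z
    by (simp add: app_def[of K "T X Y"] g_minus_left J_hat_tangent hat.g_J_left vfields_tangent
        torsion_vfields)
qed (use X Y in \<open>auto intro!: vfields_minus torsion_vfields hat.app_vfields\<close>)

text \<open>Paired with \<open>Z\<close>, the outer K of the torsion formula moves onto
  \<open>Z\<close> by skew-adjointness, which leaves the eigenvalue identity for opposite
  types.\<close>

lemma nijenhuis_J_hat:
  assumes "torsion_in A g D (pure_type A J H V)" and X: "X \<in> vfields A" and Y: "Y \<in> vfields A"
  shows "nijenhuis A K X Y = 0"
proof -
  note KX = hat.app_vfields[OF X] and KY = hat.app_vfields[OF Y]
  note vf = X Y KX KY torsion_vfields[OF X Y] torsion_vfields[OF KX KY]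
    torsion_vfields[OF KX Y] torsion_vfields[OF X KY]
  have "T X Y - T (app K X) (app K Y) + app K (T (app K X) Y) + app K (T X (app K Y)) = 0"
  proof (rule vfields_eqI)
    fix Z p assume Z: "Z \<in> vfields A"
    note KZ = hat.app_vfields[OF Z]
    note t = vfields_tangent[OF X, of p] vfields_tangent[OF Y, of p] vfields_tangent[OF Z, of p]
    obtain \<tau> where \<tau>: "\<tau> \<in> pure_type A J H V p"
      and val: "\<And>X Y Z. X \<in> vfields A \<Longrightarrow> Y \<in> vfields A \<Longrightarrow> Z \<in> vfields A \<Longrightarrow>
        \<tau> (X p, Y p, Z p) = complex_of_real (g p (T X Y p) (Z p))"
      using assms(1) unfolding torsion_in_def by blast
    obtain \<sigma> \<rho> where \<sigma>: "\<sigma> \<in> tensor21 (ext2 (forms10 A J H V p)) (forms10 A J V H p)"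
      and \<rho>: "\<rho> \<in> tensor21 (ext2 (forms01 A J H V p)) (forms01 A J V H p)" and "\<tau> = \<sigma> + \<rho>"
      using \<tau> unfolding pure_type_def subspace_sum_def by blast
    have "\<sigma> (X p, Y p, Z p) = \<sigma> (K p (X p), K p (Y p), Z p) + \<sigma> (K p (X p), Y p, K p (Z p))
        + \<sigma> (X p, K p (Y p), K p (Z p))"
      by (rule tensor21_eigen_opposite[where U = "tangent_space A p" and a = \<i>, OF \<sigma>])
        (simp_all add: forms_H_J_hat forms_V_J_hat t J_hat_tangent)
    moreover have "\<rho> (X p, Y p, Z p) = \<rho> (K p (X p), K p (Y p), Z p) + \<rho> (K p (X p), Y p, K p (Z p))
        + \<rho> (X p, K p (Y p), K p (Z p))"
      by (rule tensor21_eigen_opposite[where U = "tangent_space A p" and a = "-\<i>", OF \<rho>])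
        (simp_all add: forms_H_J_hat forms_V_J_hat t J_hat_tangent)
    ultimately have "\<tau> (X p, Y p, Z p) = \<tau> (app K X p, app K Y p, Z p) + \<tau> (app K X p, Y p, app K Z p)
        + \<tau> (X p, app K Y p, app K Z p)"
      by (simp add: \<open>\<tau> = \<sigma> + \<rho>\<close> app_def)
    then have "complex_of_real (g p (T X Y p) (Z p)) = complex_of_real (g p (T (app K X) (app K Y) p) (Z p)
        + g p (T (app K X) Y p) (app K Z p) + g p (T X (app K Y) p) (app K Z p))"
      using X Y Z KX KY KZ by (simp add: val)
    then have "g p (T X Y p) (Z p) = g p (T (app K X) (app K Y) p) (Z p)
        + g p (T (app K X) Y p) (app K Z p) + g p (T X (app K Y) p) (app K Z p)"
      by (simp only: of_real_eq_iff)
    moreover have "g p (app K W p) (Z p) = - g p (W p) (app K Z p)" if "W \<in> vfields A" for W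
      using that Z by (simp add: app_def hat.g_J_left vfields_tangent)
    ultimately show "g p ((T X Y - T (app K X) (app K Y) + app K (T (app K X) Y) + app K (T X (app K Y))) p) (Z p)
        = g p (0 p) (Z p)"
      \<comment> \<open>The instance with scalar 0 yields \<open>g p 0 (Z p) = 0\<close> for the
        right-hand side.\<close>
      using vf Z g_scale_left[OF tangent_zero vfields_tangent[OF Z], of p 0]
      by (simp add: g_bilinear tangent_closed vfields_tangent hat.app_vfields)
  qed (use vf in \<open>auto intro!: vfields_zero vfields_add vfields_diff hat.app_vfields\<close>)
  then show ?thesis by (simp add: hat.nijenhuis_torsion[OF X Y])
qed

end

theorem proposition3p2:
  fixes A :: "('a::{t2_space,second_countable_topology}, 'e::euclidean_space) atlas"
    and g :: "'a metric_field" and J :: "'a endo_field" and Da :: "'a connection"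
    and H V :: "'a distribution" and m :: nat
  assumes "manifold A" and "connected (UNIV :: 'a set)" and "DIM('e) = 2 * m + 2"
    and "skew_torsion_connection A g J Da"
    and "parallel_splitting A g J Da m H V"
  shows "(hermitian A g J \<and> torsion_in A g Da (mixed_type A J H V) \<longrightarrow>
           nearly_kahler A g (J_hat J H V) \<and>
           (\<forall>X\<in>vfields A. \<forall>Y\<in>vfields A. canonical_connection A g (J_hat J H V) X Y = Da X Y)) \<and>
         (nearly_kahler A g J \<and> torsion_in A g Da (pure_type A J H V) \<longrightarrow>
           hermitian A g (J_hat J H V) \<and>
           skew_torsion_connection A g (J_hat J H V) Da \<and>
           (\<forall>D. skew_torsion_connection A g (J_hat J H V) D \<longrightarrow>
             (\<forall>X\<in>vfields A. \<forall>Y\<in>vfields A. D X Y = Da X Y)))"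
proof -
  \<comment> \<open>The two parts share an almost Hermitian structure with a parallel splitting, so
    the locale is established once from that common ground.\<close>
  have splitting: "parallel_hermitian_splitting A g J H V Da" if ah: "almost_hermitian A g J"
  proof -
    interpret almost_hermitian_manifold A g J
      using assms(1) ah by unfold_locales (auto simp: almost_hermitian_def)
    interpret skew_torsion_hermitian A g J Da
      using assms(4) by (rule skew_torsion_hermitianI)
    note splitting = assms(5)[unfolded parallel_splitting_def]
    from splitting have H: "\<forall>p. subspace (H p) \<and> H p \<subseteq> tangent_space A p"
      by (simp add: subbundle_def)
    show ?thesis
    proof unfold_locales
      show "subspace (H p)" "h \<in> H p \<Longrightarrow> h \<in> tangent_space A p" for p h
        using H by blast+
      show "subbundle A 2 V" "parallel_subbundle A Da H" "parallel_subbundle A Da V"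
        "H p \<inter> V p = {0}" "{h + w | h w. h \<in> H p \<and> w \<in> V p} = tangent_space A p"
        "h \<in> H p \<Longrightarrow> w \<in> V p \<Longrightarrow> g p h w = 0" for p h w
        using splitting by simp_all
      show "h \<in> H p \<Longrightarrow> J p h \<in> H p" "w \<in> V p \<Longrightarrow> J p w \<in> V p" for p h w
        using splitting by (simp_all add: image_subset_iff)
    qed
  qed
  show ?thesis
  proof (intro conjI impI; elim conjE)
    assume "hermitian A g J" and torsion: "torsion_in A g Da (mixed_type A J H V)"
    then interpret parallel_hermitian_splitting A g J H V Da
      by (intro splitting) (simp add: hermitian_def)
    show "nearly_kahler A g (J_hat J H V)"
      "\<forall>X\<in>vfields A. \<forall>Y\<in>vfields A. canonical_connection A g (J_hat J H V) X Y = Da X Y"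
      using hat.nearly_kahler_and_canonical[OF torsion_J_hat[OF torsion]] by blast+
  next
    assume "nearly_kahler A g J" and torsion: "torsion_in A g Da (pure_type A J H V)"
    then interpret parallel_hermitian_splitting A g J H V Da
      by (intro splitting) (simp add: nearly_kahler_def)
    show "hermitian A g (J_hat J H V)"
      using almost_hermitian_J_hat nijenhuis_J_hat[OF torsion] by (simp add: hermitian_def)
    show "skew_torsion_connection A g (J_hat J H V) Da"
      by (rule hat.skew_torsion_connection)
    show "\<forall>D. skew_torsion_connection A g (J_hat J H V) D \<longrightarrow>
        (\<forall>X\<in>vfields A. \<forall>Y\<in>vfields A. D X Y = Da X Y)"
      using hat.skew_torsion_connection_unique by blast
  qed
qed

end
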